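(* Let $(\mathcal{F}_1,\mathcal{F}_2)$ be a claw-free pair of trapdoor permutations with common key generator $G$, and let $\mathcal{S}$ be the Full Domain Hash signature scheme instantiated with $\mathcal{F}_1$. Consider the following reduction from a classical adversary $A$ for $\mathcal{S}$ to a classical algorithm $B$ for finding claws of $(\mathcal{F}_1,\mathcal{F}_2)$. The classical random oracle $O_c(r)$ of the reduction returns a random pair $(a,b)$, where $a$ is a uniformly random element of the common domain of $f_1(\mathsf{pk},\cdot)$ and $f_2(\mathsf{pk},\cdot)$ and $b$ is uniformly random in $\{1,\dots,p\}$, for a suitably chosen $p$: - on input $\mathsf{pk}$, $B$ computes $\mathrm{START}(\mathsf{pk})=(\mathsf{pk},\mathsf{pk})$ and simulates $A$ on $\mathsf{pk}$; - $\mathrm{RAND}^{O_c}(r,\mathsf{pk})$: compute $(a,b)\leftarrow O_c(r)$; if $b=1$ return $f_2(\mathsf{pk},a)$, otherwise return $f_1(\mathsf{pk},a)$; - $\mathrm{SIGN}^{O_c}(m,\mathsf{pk})$: compute $(a,b)\leftarrow O_c(m)$; return $a$ if $b\ne1$, otherwise fail (abort); - $\mathrm{FINISH}^{O_c}(m,\sigma,\mathsf{pk})$: compute $(a,b)\leftarrow O_c(m)$ and output $(\sigma,a)$; - $\mathrm{INSTANCE}(\mathsf{pk})=\mathsf{pk}$. For a suitable choice of $p$ (depending on the number of signing queries of $A$), this reduction is history-free.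
   Context: **Quantum oracle access.** A quantum algorithm with quantum access to a function $O$ may apply the unitary $|x,y\rangle\mapsto|x,y\oplus O(x)\rangle$. The variational distance of distributions $D_1,D_2$ on $\Omega$ is $\sum_{x\in\Omega}|\Pr[x|D_1]-\Pr[x|D_2]|$. An oracle $O'$ is (quantum) computationally indistinguishable from a random oracle if for every polynomial-time quantum algorithm with quantum oracle access, the variational distance between its output distributions with oracle $O'$ and with a truly random oracle is negligible in $n$. **Trapdoor permutation.** $\mathcal{F}=(G,f,f^{-1})$: $G(1^n)$ generates $(\mathsf{sk},\mathsf{pk})$, $f(\mathsf{pk},\cdot)$ is a permutation for all $\mathsf{pk}$, and $f^{-1}(\mathsf{sk},\cdot)$ is the inverse of $f(\mathsf{pk},\cdot)$. **Claw-free pair.** A pair of trapdoor permutations $(\mathcal{F}_1,\mathcal{F}_2)$, $\mathcal{F}_i=(G_i,f_i,f_i^{-1})$, such that $G_1=G_2=:G$; for any $\mathsf{pk}$, $f_1(\mathsf{pk},\cdot)$ and $f_2(\mathsf{pk},\cdot)$ have the same domain and range; and, given only $\mathsf{pk}$, any PPT adversary finds a claw, i.e. a pair $(x_1,x_2)$ with $f_1(\mathsf{pk},x_1)=f_2(\mathsf{pk},x_2)$, with only negligible probability. The associated problem: the challenger runs $G(1^n)$ and sends $\mathsf{pk}$; the adversary wins (challenger outputs $1$) iff it outputs a claw. **FDH instantiated with $\mathcal{F}_1$.** With a random oracle $O$ whose range is the range of $f_1$: key generation is $G$; $S^O(\mathsf{sk},m)=f_1^{-1}(\mathsf{sk},O(m))$;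 $V^O(\mathsf{pk},m,\sigma)=1$ iff $f_1(\mathsf{pk},\sigma)=O(m)$. A forgery $(m,\sigma)$ by an adversary making signing queries is valid if no signature on $m$ was requested and $V^O(\mathsf{pk},m,\sigma)=1$. **History-free reduction.** A reduction from a problem $P$ for a random oracle signature scheme $\mathcal{S}=(G,S^O,V^O)$, using a classical PPT adversary $A$ for $\mathcal{S}$ to construct a classical PPT algorithm $B$ for $P$, is history-free if: - $B$ consists of classical algorithms $\mathrm{START}$, $\mathrm{RAND}^{O_c}$, $\mathrm{SIGN}^{O_c}$, $\mathrm{FINISH}^{O_c}$, the latter three sharing a classical random oracle $O_c$ (all but $\mathrm{RAND}$ may also query the challenger for $P$), used thus: given an instance $x$ of $P$, $B$ runs $\mathrm{START}(x)$ to get $(\mathsf{pk},z)$ and sends $\mathsf{pk}$ to $A$; random oracle queries $O(r)$ of $A$ are answered by $\mathrm{RAND}^{O_c}(r,z)$; signature queries on $m$ are answered by $\mathrm{SIGN}^{O_c}(m,z)$; when $A$ outputs $(m,\sigma)$, $B$ outputs $\mathrm{FINISH}^{O_c}(m,\sigma,z)$. - There is an efficiently computable function $\mathrm{INSTANCE}(\mathsf{pk})$ producing an instance $x$ of $P$ with $\mathrm{START}(x)=(\mathsf{pk},z)$ for some $z$; when $(\mathsf{sk},\mathsf{pk})\leftarrow G(1^n)$, the distribution of $x=\mathrm{INSTANCE}(\mathsf{pk})$ is negligibly close to the distribution of instances $x$ in the game of $P$. - For fixed $z$, with $O(r)=\mathrm{RAND}^{O_c}(r,z)$, the quantum oracle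 $O_{\mathrm{quant}}:|x,y\rangle\mapsto|x,y\oplus O(x)\rangle$ is quantum computationally indistinguishable from a random oracle. - $\mathrm{SIGN}^{O_c}$ either aborts (and hence $B$ aborts) or generates a valid signature relative to the oracle $O(r)=\mathrm{RAND}^{O_c}(r,z)$ with a distribution negligibly close to the correct signing algorithm; the probability that none of the signature queries abort is non-negligible. - If $(m,\sigma)$ is a valid signature forgery relative to $\mathsf{pk}$ and the oracle $O(r)=\mathrm{RAND}^{O_c}(r,z)$, then $\mathrm{FINISH}^{O_c}(m,\sigma,z)$ causes the challenger for $P$ to output $1$ with non-negligible probability. *)

theory Defs
  imports "HOL-Probability.Probability" "HOL-Computational_Algebra.Polynomial"
begin

section \<open>Asymptotics and distances\<close>

definition negligible :: "(nat \<Rightarrow> real) \<Rightarrow> bool" where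
  "negligible f \<longleftrightarrow> (\<forall>c::nat. \<forall>\<^sub>F n in sequentially. \<bar>f n\<bar> \<le> 1 / real n ^ c)"

text \<open>
  Non-negligible probabilities are read as bounded below by an inverse polynomial for all large
  \<open>n\<close>. This implies \<open>\<not> negligible f\<close>, and it is the form that is preserved by products.
\<close>

definition non_negligible :: "(nat \<Rightarrow> real) \<Rightarrow> bool" where
  "non_negligible f \<longleftrightarrow> (\<exists>c::nat. \<forall>\<^sub>F n in sequentially. f n \<ge> 1 / real n ^ c)"

lemma non_negligible_imp_not_negligible:
  assumes "non_negligible f" shows "\<not> negligible f"
proof
  assume neg: "negligible f"
  from assms obtain c where c: "\<forall>\<^sub>F n in sequentially. f n \<ge> 1 / real n ^ c"
    by (auto simp: non_negligible_def)
  from neg have "\<forall>\<^sub>F n in sequentially. \<bar>f n\<bar> \<le> 1 / real n ^ Suc c"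
    unfolding negligible_def by blast
  with c have "\<forall>\<^sub>F n in sequentially. 1 / real n ^ c \<le> 1 / real n ^ Suc c"
    by eventually_elim linarith
  moreover have "\<forall>\<^sub>F n in sequentially. (n::nat) \<ge> 2" by (rule eventually_ge_at_top)
  ultimately have "\<forall>\<^sub>F n::nat in sequentially. False"
  proof eventually_elim
    case (elim n)
    have pos: "real n ^ c > 0" using elim(2) by simp
    have "1 / real n ^ Suc c < 1 / real n ^ c"
      using pos elim(2) by (simp add: field_simps)
    with elim(1) show False by linarith
  qed
  thus False by simp
qed

text \<open>
  The variational distance without the factor \<open>1/2\<close>, for (sub)probability mass functions;
  for these the sum always converges.
\<close>

definition vdist :: "('a \<Rightarrow> real) \<Rightarrow> ('a \<Rightarrow> real) \<Rightarrow> real" where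
  "vdist p q = (\<Sum>\<^sub>\<infinity>x. \<bar>p x - q x\<bar>)"


section \<open>Classical polynomial-time algorithms with oracles\<close>

type_synonym bits = "bool list"

text \<open>
  Algorithms are while programs over registers that hold bit strings, i.e. multi-stack machines.
  \<open>Ask i r r'\<close> queries the \<open>i\<close>-th oracle on the contents of register \<open>r\<close> and stores
  the answer in register \<open>r'\<close>.  The cost of a copy or of a query is the number of bits moved.
  Programs are deterministic: randomness is an additional uniformly random input string.
\<close>

datatype test = Nonempty nat | Head nat

datatype prog =
    Skip
  | Push nat bool
  | Pop nat
  | Copy nat nat
  | Ask nat nat nat
  | Seq prog prog
  | Cond test prog prog
  | While test prog

type_synonym store = "nat \<Rightarrow> bits"
type_synonym oracles = "nat \<Rightarrow> bits \<Rightarrow> bits"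
type_synonym transcript = "(nat \<times> bits \<times> bits) list"

fun holds :: "test \<Rightarrow> store \<Rightarrow> bool" where
  "holds (Nonempty r) s \<longleftrightarrow> s r \<noteq> []"
| "holds (Head r) s \<longleftrightarrow> s r \<noteq> [] \<and> hd (s r)"

text \<open>
  \<open>exec \<Omega> P s t \<tau> s'\<close>: with oracles \<open>\<Omega>\<close> and initial store \<open>s\<close>, program \<open>P\<close> halts
  after \<open>t\<close> steps in store \<open>s'\<close>, and \<open>\<tau>\<close> lists its oracle queries and their answers.
\<close>

inductive exec :: "oracles \<Rightarrow> prog \<Rightarrow> store \<Rightarrow> nat \<Rightarrow> transcript \<Rightarrow> store \<Rightarrow> bool"
  for \<Omega> :: oracles where
  Skip: "exec \<Omega> Skip s 1 [] s"
| Push: "exec \<Omega> (Push r b) s 1 [] (s(r := b # s r))"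
| Pop: "exec \<Omega> (Pop r) s 1 [] (s(r := tl (s r)))"
| Copy: "exec \<Omega> (Copy r' r) s (1 + length (s r)) [] (s(r' := s r))"
| Ask: "exec \<Omega> (Ask i r r') s (1 + length (s r) + length (\<Omega> i (s r)))
          [(i, s r, \<Omega> i (s r))] (s(r' := \<Omega> i (s r)))"
| Seq: "exec \<Omega> P s t \<tau> s' \<Longrightarrow> exec \<Omega> Q s' t' \<tau>' s'' \<Longrightarrow>
          exec \<Omega> (Seq P Q) s (t + t') (\<tau> @ \<tau>') s''"
| CondT: "holds c s \<Longrightarrow> exec \<Omega> P s t \<tau> s' \<Longrightarrow> exec \<Omega> (Cond c P Q) s (1 + t) \<tau> s'"
| CondF: "\<not> holds c s \<Longrightarrow> exec \<Omega> Q s t \<tau> s' \<Longrightarrow> exec \<Omega> (Cond c P Q) s (1 + t) \<tau> s'"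
| WhileF: "\<not> holds c s \<Longrightarrow> exec \<Omega> (While c P) s 1 [] s"
| WhileT: "holds c s \<Longrightarrow> exec \<Omega> P s t \<tau> s' \<Longrightarrow> exec \<Omega> (While c P) s' t' \<tau>' s'' \<Longrightarrow>
          exec \<Omega> (While c P) s (1 + t + t') (\<tau> @ \<tau>') s''"

lemma exec_deterministic:
  assumes "exec \<Omega> P s t \<tau> s'" and "exec \<Omega> P s u \<upsilon> s''"
  shows "u = t \<and> \<upsilon> = \<tau> \<and> s'' = s'"
  using assms
proof (induction arbitrary: u \<upsilon> s'' rule: exec.induct)
  case (Seq P s t \<tau> s' Q t' \<tau>' s'')
  from Seq.prems show ?case by cases (use Seq.IH in blast)
next
  case (CondT c s P t \<tau> s' Q)
  from CondT.prems show ?case by cases (use CondT in blast)+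
next
  case (CondF c s Q t \<tau> s' P)
  from CondF.prems show ?case by cases (use CondF in blast)+
next
  case (WhileF c s P)
  from WhileF.prems show ?case by cases (use WhileF in blast)+
next
  case (WhileT c s P t \<tau> s' t' \<tau>' s'')
  from WhileT.prems show ?case by cases (use WhileT in blast)+
qed (auto elim: exec.cases)

fun ask_free :: "prog \<Rightarrow> bool" where
  "ask_free (Ask i r r') \<longleftrightarrow> False"
| "ask_free (Seq P Q) \<longleftrightarrow> ask_free P \<and> ask_free Q"
| "ask_free (Cond c P Q) \<longleftrightarrow> ask_free P \<and> ask_free Q"
| "ask_free (While c P) \<longleftrightarrow> ask_free P"
| "ask_free P \<longleftrightarrow> True"

definition no_oracles :: oracles where
  "no_oracles = (\<lambda>i r. [])"

text \<open>Inputs are placed in registers \<open>0, 1, \<dots>\<close>, and outputs are read off from there.\<close>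

definition init_store :: "bits list \<Rightarrow> store" where
  "init_store ins i = (if i < length ins then ins ! i else [])"

definition run :: "oracles \<Rightarrow> prog \<Rightarrow> bits list \<Rightarrow> nat \<times> transcript \<times> store" where
  "run \<Omega> P ins = (THE r. case r of (t, \<tau>, s) \<Rightarrow> exec \<Omega> P (init_store ins) t \<tau> s)"

definition steps :: "oracles \<Rightarrow> prog \<Rightarrow> bits list \<Rightarrow> nat" where
  "steps \<Omega> P ins = fst (run \<Omega> P ins)"

text \<open>
  A task \<open>(\<Omega>, ins, outs)\<close> asks for output \<open>outs\<close> on input \<open>ins\<close> with oracles \<open>\<Omega>\<close>.
  Time is polynomial in the total length of the inputs and the maximal length of an oracle answer.
\<close>

definition solves_in_poly_time :: "prog \<Rightarrow> (oracles \<times> bits list \<times> bits list) set \<Rightarrow> bool" where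
  "solves_in_poly_time P J \<longleftrightarrow>
     (\<exists>T :: nat poly. \<forall>(\<Omega>, ins, outs) \<in> J. \<forall>L. (\<forall>i r. length (\<Omega> i r) \<le> L) \<longrightarrow>
        (\<exists>t \<tau> s. exec \<Omega> P (init_store ins) t \<tau> s \<and> map s [0..<length outs] = outs \<and>
                 t \<le> poly T ((\<Sum>x\<leftarrow>ins. length x) + L)))"

text \<open>Every algorithm receives the security parameter in unary as its first input.\<close>

definition unary :: "nat \<Rightarrow> bits" where
  "unary n = replicate n True"

definition poly_time_computable :: "(bits list \<times> bits list) set \<Rightarrow> bool" where
  "poly_time_computable F \<longleftrightarrow>
     (\<exists>P. ask_free P \<and> solves_in_poly_time P {(no_oracles, ins, outs) | ins outs. (ins, outs) \<in> F})"

definition uniform_bits :: "nat \<Rightarrow> bits pmf" where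
  "uniform_bits k = pmf_of_set {\<rho>. length \<rho> = k}"

text \<open>A classical adversary is a program and the (polynomial) number of its random coins.\<close>

record adversary =
  adv_prog :: prog
  adv_coins :: "nat poly"

definition coins :: "adversary \<Rightarrow> nat \<Rightarrow> bits pmf" where
  "coins A n = uniform_bits (poly (adv_coins A) n)"

text \<open>The three inputs are \<open>1\<^sup>n\<close>, the public key or challenge, and the random coins.\<close>

definition ppt_adversary :: "adversary \<Rightarrow> bool" where
  "ppt_adversary A \<longleftrightarrow>
     solves_in_poly_time (adv_prog A) {(\<Omega>, ins, []) | \<Omega> ins. length ins = 3}"


section \<open>Trapdoor permutations and claw-free pairs\<close>

text \<open>\<open>tdp_gen F n\<close> is the distribution of pairs (secret key, public key).\<close>

record tdp =
  tdp_gen :: "nat \<Rightarrow> (bits \<times> bits) pmf"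
  tdp_dom :: "bits \<Rightarrow> bits set"
  tdp_eval :: "bits \<Rightarrow> bits \<Rightarrow> bits"
  tdp_inv :: "bits \<Rightarrow> bits \<Rightarrow> bits"

definition ppt_generator :: "(nat \<Rightarrow> (bits \<times> bits) pmf) \<Rightarrow> bool" where
  "ppt_generator G \<longleftrightarrow>
     (\<exists>(c :: nat poly) (g :: nat \<Rightarrow> bits \<Rightarrow> bits \<times> bits).
        poly_time_computable
          {([unary n, \<rho>], [fst (g n \<rho>), snd (g n \<rho>)]) | n \<rho>. length \<rho> = poly c n} \<and>
        (\<forall>n. G n = map_pmf (g n) (uniform_bits (poly c n))))"

text \<open>
  The elements of one domain are encoded by bit strings of the same length, so that the XOR in
  the quantum oracle is meaningful.
\<close>

definition trapdoor_permutation :: "tdp \<Rightarrow> bool" where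
  "trapdoor_permutation F \<longleftrightarrow>
     ppt_generator (tdp_gen F) \<and>
     (\<forall>n. \<forall>(sk, pk) \<in> set_pmf (tdp_gen F n).
        tdp_dom F pk \<noteq> {} \<and>
        (\<forall>x \<in> tdp_dom F pk. \<forall>y \<in> tdp_dom F pk. length x = length y) \<and>
        bij_betw (tdp_eval F pk) (tdp_dom F pk) (tdp_dom F pk) \<and>
        (\<forall>x \<in> tdp_dom F pk. tdp_inv F sk (tdp_eval F pk x) = x)) \<and>
     (\<exists>l :: nat poly. \<forall>n. \<forall>(sk, pk) \<in> set_pmf (tdp_gen F n).
        \<forall>x \<in> tdp_dom F pk. length x \<le> poly l n) \<and>
     poly_time_computable
       {([unary n, pk, x], [tdp_eval F pk x]) | n sk pk x.
          (sk, pk) \<in> set_pmf (tdp_gen F n) \<and> x \<in> tdp_dom F pk} \<and>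
     poly_time_computable
       {([unary n, sk, y], [tdp_inv F sk y]) | n sk pk y.
          (sk, pk) \<in> set_pmf (tdp_gen F n) \<and> y \<in> tdp_dom F pk}"

definition is_claw :: "tdp \<Rightarrow> tdp \<Rightarrow> bits \<Rightarrow> bits \<Rightarrow> bits \<Rightarrow> bool" where
  "is_claw F1 F2 pk x1 x2 \<longleftrightarrow>
     x1 \<in> tdp_dom F1 pk \<and> x2 \<in> tdp_dom F2 pk \<and> tdp_eval F1 pk x1 = tdp_eval F2 pk x2"

definition claw_prob :: "tdp \<Rightarrow> tdp \<Rightarrow> adversary \<Rightarrow> nat \<Rightarrow> real" where
  "claw_prob F1 F2 A n =
     measure_pmf.prob (pair_pmf (map_pmf snd (tdp_gen F1 n)) (coins A n))
       {(pk, \<rho>). case run no_oracles (adv_prog A) [unary n, pk, \<rho>] of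
                   (t, \<tau>, s) \<Rightarrow> is_claw F1 F2 pk (s 0) (s 1)}"

definition claw_free_pair :: "tdp \<Rightarrow> tdp \<Rightarrow> bool" where
  "claw_free_pair F1 F2 \<longleftrightarrow>
     trapdoor_permutation F1 \<and> trapdoor_permutation F2 \<and>
     tdp_gen F1 = tdp_gen F2 \<and>
     (\<forall>n. \<forall>(sk, pk) \<in> set_pmf (tdp_gen F1 n). tdp_dom F1 pk = tdp_dom F2 pk) \<and>
     (\<forall>A. ppt_adversary A \<and> ask_free (adv_prog A) \<longrightarrow> negligible (claw_prob F1 F2 A))"


section \<open>Quantum algorithms with quantum oracle access\<close>

text \<open>
  Circuits over the universal gate set Hadamard, T, CNOT with oracle gates
  \<open>|x, y\<rangle> \<mapsto> |x, y \<oplus> O(x)\<rangle>\<close> acting on a list of input and a list of output wires.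
\<close>

datatype gate =
    Hadamard nat
  | TGate nat
  | CNot nat nat
  | QAsk "nat list" "nat list"

record circuit =
  wires :: nat
  gates :: "gate list"

fun gate_ok :: "nat \<Rightarrow> gate \<Rightarrow> bool" where
  "gate_ok w (Hadamard i) \<longleftrightarrow> i < w"
| "gate_ok w (TGate i) \<longleftrightarrow> i < w"
| "gate_ok w (CNot i j) \<longleftrightarrow> i < w \<and> j < w \<and> i \<noteq> j"
| "gate_ok w (QAsk xs ys) \<longleftrightarrow>
     set xs \<subseteq> {..<w} \<and> set ys \<subseteq> {..<w} \<and> distinct xs \<and> distinct ys \<and> set xs \<inter> set ys = {}"

definition circuit_ok :: "circuit \<Rightarrow> bool" where
  "circuit_ok C \<longleftrightarrow> (\<forall>g \<in> set (gates C). gate_ok (wires C) g)"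

text \<open>A state maps each computational basis vector to its amplitude.\<close>

type_synonym qstate = "bits \<Rightarrow> complex"

fun xor_wires :: "nat list \<Rightarrow> bits \<Rightarrow> bits \<Rightarrow> bits" where
  "xor_wires (y # ys) (v # vs) b = xor_wires ys vs (b[y := (b ! y \<noteq> v)])"
| "xor_wires _ _ b = b"

text \<open>
  CNOT and oracle gates permute the basis vectors by involutions, so the new amplitude at \<open>b\<close> is
  the old amplitude at the image of \<open>b\<close>.
\<close>

fun apply_gate :: "(bits \<Rightarrow> bits) \<Rightarrow> gate \<Rightarrow> qstate \<Rightarrow> qstate" where
  "apply_gate f (Hadamard i) \<psi> =
     (\<lambda>b. (\<psi> (b[i := False]) + (if b ! i then - 1 else 1) * \<psi> (b[i := True])) / sqrt 2)"
| "apply_gate f (TGate i) \<psi> = (\<lambda>b. (if b ! i then cis (pi / 4) else 1) * \<psi> b)"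
| "apply_gate f (CNot i j) \<psi> = (\<lambda>b. \<psi> (b[j := (b ! j \<noteq> b ! i)]))"
| "apply_gate f (QAsk xs ys) \<psi> = (\<lambda>b. \<psi> (xor_wires ys (f (map (\<lambda>i. b ! i) xs)) b))"

text \<open>
  Probability of measuring \<open>b\<close> on all wires when starting from \<open>|0\<dots>0\<rangle>\<close>; classical inputs are
  built into the circuit.
\<close>

definition measure_prob :: "circuit \<Rightarrow> (bits \<Rightarrow> bits) \<Rightarrow> bits \<Rightarrow> real" where
  "measure_prob C f b =
     (cmod (fold (apply_gate f) (gates C)
              (\<lambda>b'. if b' = replicate (wires C) False then 1 else 0) b))\<^sup>2"

definition enc_nat :: "nat \<Rightarrow> bits" where
  "enc_nat k = replicate k True @ [False]"

definition enc_nats :: "nat list \<Rightarrow> bits" where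
  "enc_nats ks = concat (map enc_nat (length ks # ks))"

fun enc_gate :: "gate \<Rightarrow> bits" where
  "enc_gate (Hadamard i) = enc_nat 0 @ enc_nat i"
| "enc_gate (TGate i) = enc_nat 1 @ enc_nat i"
| "enc_gate (CNot i j) = enc_nat 2 @ enc_nat i @ enc_nat j"
| "enc_gate (QAsk xs ys) = enc_nat 3 @ enc_nats xs @ enc_nats ys"

definition enc_circuit :: "circuit \<Rightarrow> bits" where
  "enc_circuit C = enc_nat (wires C) @ enc_nat (length (gates C)) @ concat (map enc_gate (gates C))"

text \<open>
  A polynomial-time quantum algorithm is a uniform family: a classical polynomial-time program
  maps the \<open>k\<close> classical inputs to the description of the circuit.
\<close>

definition quantum_poly_time :: "nat \<Rightarrow> (bits list \<Rightarrow> circuit) \<Rightarrow> bool" where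
  "quantum_poly_time k Q \<longleftrightarrow>
     (\<forall>ins. length ins = k \<longrightarrow> circuit_ok (Q ins)) \<and>
     poly_time_computable {(ins, [enc_circuit (Q ins)]) | ins. length ins = k}"

definition random_oracle :: "'a pmf \<Rightarrow> (bits \<Rightarrow> 'a) measure" where
  "random_oracle d = (\<Pi>\<^sub>M r \<in> UNIV. measure_pmf d)"


section \<open>Signature schemes in the random oracle model\<close>

text \<open>The random oracle of the scheme has uniform values in \<open>sig_range S pk\<close>.\<close>

record sigscheme =
  sig_gen :: "nat \<Rightarrow> (bits \<times> bits) pmf"
  sig_range :: "bits \<Rightarrow> bits set"
  sig_sign :: "(bits \<Rightarrow> bits) \<Rightarrow> bits \<Rightarrow> bits \<Rightarrow> bits pmf"
  sig_verify :: "(bits \<Rightarrow> bits) \<Rightarrow> bits \<Rightarrow> bits \<Rightarrow> bits \<Rightarrow> bool"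

definition fdh :: "tdp \<Rightarrow> sigscheme" where
  "fdh F = \<lparr> sig_gen = tdp_gen F,
             sig_range = tdp_dom F,
             sig_sign = (\<lambda>H sk m. return_pmf (tdp_inv F sk (H m))),
             sig_verify = (\<lambda>H pk m \<sigma>. \<sigma> \<in> tdp_dom F pk \<and> tdp_eval F pk \<sigma> = H m) \<rparr>"

text \<open>Oracle 0 of a forger is the hash function, oracle 1 the signing oracle.\<close>

definition forger_oracles :: "(bits \<Rightarrow> bits) \<Rightarrow> (bits \<Rightarrow> bits) \<Rightarrow> oracles" where
  "forger_oracles H Sg i r = (if i = 0 then H r else if i = 1 then Sg r else [])"

definition signed :: "transcript \<Rightarrow> bits list" where
  "signed \<tau> = [r. (i, r, y) \<leftarrow> \<tau>, i = 1]"

text \<open>The number of signing queries is bounded in genuine attacks on \<open>S\<close> only.\<close>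

definition signing_queries_le :: "sigscheme \<Rightarrow> adversary \<Rightarrow> (nat \<Rightarrow> nat) \<Rightarrow> bool" where
  "signing_queries_le S A q \<longleftrightarrow>
     (\<forall>n. \<forall>(sk, pk) \<in> set_pmf (sig_gen S n). \<forall>\<rho> \<in> set_pmf (coins A n). \<forall>H Sg.
        (\<forall>r. H r \<in> sig_range S pk) \<longrightarrow> (\<forall>m. Sg m \<in> set_pmf (sig_sign S H sk m)) \<longrightarrow>
        (case run (forger_oracles H Sg) (adv_prog A) [unary n, pk, \<rho>] of
           (t, \<tau>, s) \<Rightarrow> length (signed \<tau>) \<le> q n))"


section \<open>History-free reductions\<close>

text \<open>
  A problem is given by its instance distribution and the verdict of the challenger on an
  instance and an answer. The challenger of such a problem answers no further queries.
\<close>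

record problem =
  pr_inst :: "nat \<Rightarrow> bits pmf"
  pr_wins :: "bits \<Rightarrow> bits list \<Rightarrow> bool"

definition claw_problem :: "tdp \<Rightarrow> tdp \<Rightarrow> problem" where
  "claw_problem F1 F2 =
     \<lparr> pr_inst = (\<lambda>n. map_pmf snd (tdp_gen F1 n)),
       pr_wins = (\<lambda>pk ans. \<exists>x1 x2. ans = [x1, x2] \<and> is_claw F1 F2 pk x1 x2) \<rparr>"

text \<open>
  \<open>rd_oc n x\<close> is the distribution of a single value of the classical random oracle \<open>O\<^sub>c\<close> when
  the instance is \<open>x\<close>, and \<open>rd_enc\<close> encodes its values for the programs of the reduction.
  All randomness of the algorithms below comes from \<open>O\<^sub>c\<close>. The result \<open>None\<close> of \<open>rd_sign\<close>
  stands for an abort.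
\<close>

record 'c reduction =
  rd_oc :: "nat \<Rightarrow> bits \<Rightarrow> 'c pmf"
  rd_enc :: "'c \<Rightarrow> bits"
  rd_start :: "bits \<Rightarrow> bits \<times> bits"
  rd_rand :: "(bits \<Rightarrow> 'c) \<Rightarrow> bits \<Rightarrow> bits \<Rightarrow> bits"
  rd_sign :: "(bits \<Rightarrow> 'c) \<Rightarrow> bits \<Rightarrow> bits \<Rightarrow> bits option"
  rd_finish :: "(bits \<Rightarrow> 'c) \<Rightarrow> bits \<Rightarrow> bits \<Rightarrow> bits \<Rightarrow> bits list"
  rd_instance :: "bits \<Rightarrow> bits"

definition oc_values :: "'c reduction \<Rightarrow> nat \<Rightarrow> bits \<Rightarrow> (bits \<Rightarrow> 'c) set" where
  "oc_values R n x = {Oc. \<forall>r. Oc r \<in> set_pmf (rd_oc R n x)}"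

definition oc_oracles :: "'c reduction \<Rightarrow> (bits \<Rightarrow> 'c) \<Rightarrow> oracles" where
  "oc_oracles R Oc = (\<lambda>i r. rd_enc R (Oc r))"

fun enc_opt :: "bits option \<Rightarrow> bits" where
  "enc_opt None = [False]"
| "enc_opt (Some \<sigma>) = True # \<sigma>"

text \<open>
  The forger's run inside the reduction. An aborting signing query is answered by the empty
  string; everything after the first abort is irrelevant, as \<open>no_abort\<close> below is then false.
\<close>

definition sim_run ::
  "'c reduction \<Rightarrow> adversary \<Rightarrow> nat \<Rightarrow> bits \<Rightarrow> bits \<Rightarrow> (bits \<Rightarrow> 'c) \<Rightarrow> nat \<times> transcript \<times> store" where
  "sim_run R A n x \<rho> Oc =
     (case rd_start R x of (pk, z) \<Rightarrow>
        run (forger_oracles (\<lambda>r. rd_rand R Oc r z)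
               (\<lambda>m. case rd_sign R Oc m z of None \<Rightarrow> [] | Some \<sigma> \<Rightarrow> \<sigma>))
          (adv_prog A) [unary n, pk, \<rho>])"

definition no_abort ::
  "'c reduction \<Rightarrow> adversary \<Rightarrow> nat \<Rightarrow> bits \<Rightarrow> bits \<Rightarrow> (bits \<Rightarrow> 'c) \<Rightarrow> bool" where
  "no_abort R A n x \<rho> Oc \<longleftrightarrow>
     (case (rd_start R x, sim_run R A n x \<rho> Oc) of ((pk, z), (t, \<tau>, s)) \<Rightarrow>
        \<forall>m \<in> set (signed \<tau>). rd_sign R Oc m z \<noteq> None)"

definition valid_forgery ::
  "sigscheme \<Rightarrow> 'c reduction \<Rightarrow> adversary \<Rightarrow> nat \<Rightarrow> bits \<Rightarrow> bits \<Rightarrow> (bits \<Rightarrow> 'c) \<Rightarrow> bool" where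
  "valid_forgery S R A n x \<rho> Oc \<longleftrightarrow>
     (case (rd_start R x, sim_run R A n x \<rho> Oc) of ((pk, z), (t, \<tau>, s)) \<Rightarrow>
        s 0 \<notin> set (signed \<tau>) \<and> sig_verify S (\<lambda>r. rd_rand R Oc r z) pk (s 0) (s 1))"

definition solves_problem ::
  "problem \<Rightarrow> 'c reduction \<Rightarrow> adversary \<Rightarrow> nat \<Rightarrow> bits \<Rightarrow> bits \<Rightarrow> (bits \<Rightarrow> 'c) \<Rightarrow> bool" where
  "solves_problem P R A n x \<rho> Oc \<longleftrightarrow>
     (case (rd_start R x, sim_run R A n x \<rho> Oc) of ((pk, z), (t, \<tau>, s)) \<Rightarrow>
        pr_wins P x (rd_finish R Oc (s 0) (s 1) z))"

definition game_prob ::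
  "problem \<Rightarrow> 'c reduction \<Rightarrow> adversary \<Rightarrow> nat \<Rightarrow> (bits \<Rightarrow> bits \<Rightarrow> (bits \<Rightarrow> 'c) \<Rightarrow> bool) \<Rightarrow> real" where
  "game_prob P R A n E =
     measure_pmf.expectation (pair_pmf (pr_inst P n) (coins A n))
       (\<lambda>(x, \<rho>). measure (random_oracle (rd_oc R n x)) {Oc. E x \<rho> Oc})"

text \<open>
  Running time of the algorithm \<open>B\<close> composed of the forger and of programs \<open>PS\<close>, \<open>PR\<close>,
  \<open>PG\<close>, \<open>PF\<close> for the four parts of the reduction.
\<close>

definition total_time ::
  "'c reduction \<Rightarrow> adversary \<Rightarrow> prog \<Rightarrow> prog \<Rightarrow> prog \<Rightarrow> prog \<Rightarrow>
     nat \<Rightarrow> bits \<Rightarrow> bits \<Rightarrow> (bits \<Rightarrow> 'c) \<Rightarrow> nat" where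
  "total_time R A PS PR PG PF n x \<rho> Oc =
     (case (rd_start R x, sim_run R A n x \<rho> Oc) of ((pk, z), (t, \<tau>, s)) \<Rightarrow>
        steps no_oracles PS [unary n, x] + t +
        (\<Sum>(i, r, y) \<leftarrow> \<tau>.
           if i = 0 then steps (oc_oracles R Oc) PR [unary n, r, z]
           else if i = 1 then steps (oc_oracles R Oc) PG [unary n, r, z] else 0) +
        steps (oc_oracles R Oc) PF [unary n, s 0, s 1, z])"

definition hf_efficient :: "problem \<Rightarrow> 'c reduction \<Rightarrow> adversary \<Rightarrow> bool" where
  "hf_efficient P R A \<longleftrightarrow>
     (\<exists>PS PR PG PF.
        ask_free PS \<and>
        solves_in_poly_time PS
          {(no_oracles, [unary n, x], [fst (rd_start R x), snd (rd_start R x)]) | n x.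
             x \<in> set_pmf (pr_inst P n)} \<and>
        solves_in_poly_time PR
          {(oc_oracles R Oc, [unary n, r, snd (rd_start R x)],
              [rd_rand R Oc r (snd (rd_start R x))]) | n x Oc r.
             x \<in> set_pmf (pr_inst P n) \<and> Oc \<in> oc_values R n x} \<and>
        solves_in_poly_time PG
          {(oc_oracles R Oc, [unary n, m, snd (rd_start R x)],
              [enc_opt (rd_sign R Oc m (snd (rd_start R x)))]) | n x Oc m.
             x \<in> set_pmf (pr_inst P n) \<and> Oc \<in> oc_values R n x} \<and>
        solves_in_poly_time PF
          {(oc_oracles R Oc, [unary n, m, \<sigma>, snd (rd_start R x)],
              rd_finish R Oc m \<sigma> (snd (rd_start R x))) | n x Oc m \<sigma>.
             x \<in> set_pmf (pr_inst P n) \<and> Oc \<in> oc_values R n x} \<and>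
        (\<exists>T :: nat poly. \<forall>n. \<forall>x \<in> set_pmf (pr_inst P n). \<forall>\<rho> \<in> set_pmf (coins A n).
           \<forall>Oc \<in> oc_values R n x. total_time R A PS PR PG PF n x \<rho> Oc \<le> poly T n))"

definition hf_instance :: "sigscheme \<Rightarrow> problem \<Rightarrow> 'c reduction \<Rightarrow> bool" where
  "hf_instance S P R \<longleftrightarrow>
     poly_time_computable
       {([unary n, pk], [rd_instance R pk]) | n sk pk. (sk, pk) \<in> set_pmf (sig_gen S n)} \<and>
     (\<forall>n. \<forall>(sk, pk) \<in> set_pmf (sig_gen S n). \<exists>z. rd_start R (rd_instance R pk) = (pk, z)) \<and>
     negligible (\<lambda>n. vdist (pmf (map_pmf (\<lambda>(sk, pk). rd_instance R pk) (sig_gen S n)))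
                           (pmf (pr_inst P n)))"

text \<open>
  The distinguisher receives \<open>1\<^sup>n\<close> and the fixed \<open>pk\<close> and \<open>z\<close>; the bound on its
  distinguishing probability is uniform in these.
\<close>

definition hf_rand :: "sigscheme \<Rightarrow> problem \<Rightarrow> 'c reduction \<Rightarrow> bool" where
  "hf_rand S P R \<longleftrightarrow>
     (\<forall>Q. quantum_poly_time 3 Q \<longrightarrow>
        (\<exists>\<mu>. negligible \<mu> \<and>
          (\<forall>n. \<forall>x \<in> set_pmf (pr_inst P n). \<forall>pk z. rd_start R x = (pk, z) \<longrightarrow>
             vdist
               (\<lambda>b. \<integral>Oc. measure_prob (Q [unary n, pk, z]) (\<lambda>r. rd_rand R Oc r z) b
                      \<partial>random_oracle (rd_oc R n x))
               (\<lambda>b. \<integral>H. measure_prob (Q [unary n, pk, z]) H b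
                      \<partial>random_oracle (pmf_of_set (sig_range S pk)))
             \<le> \<mu> n)))"

text \<open>
  Conditioned on no abort, the simulated signature is compared with a correct one jointly with the
  values of the simulated hash function at arbitrary points \<open>rs\<close>, since the signature has to fit
  to that function. If \<open>rd_sign\<close> aborts with probability 1, both sides are 0.
\<close>

definition hf_sign :: "sigscheme \<Rightarrow> problem \<Rightarrow> 'c reduction \<Rightarrow> bool" where
  "hf_sign S P R \<longleftrightarrow>
     (\<forall>n. \<forall>x \<in> set_pmf (pr_inst P n). \<forall>pk z m \<sigma>. \<forall>Oc \<in> oc_values R n x.
        rd_start R x = (pk, z) \<longrightarrow> rd_sign R Oc m z = Some \<sigma> \<longrightarrow>
        sig_verify S (\<lambda>r. rd_rand R Oc r z) pk m \<sigma>) \<and>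
     (\<exists>\<mu>. negligible \<mu> \<and>
       (\<forall>n. \<forall>x \<in> set_pmf (pr_inst P n). \<forall>(sk, pk) \<in> set_pmf (sig_gen S n). \<forall>z m rs.
          rd_start R x = (pk, z) \<longrightarrow>
          (let M = random_oracle (rd_oc R n x);
               N = measure M {Oc. rd_sign R Oc m z \<noteq> None}
           in vdist
                (\<lambda>(ys, \<sigma>).
                   measure M {Oc. map (\<lambda>r. rd_rand R Oc r z) rs = ys \<and> rd_sign R Oc m z = Some \<sigma>}
                   / N)
                (\<lambda>(ys, \<sigma>).
                   (\<integral>Oc. (if map (\<lambda>r. rd_rand R Oc r z) rs = ys \<and> rd_sign R Oc m z \<noteq> None
                          then pmf (sig_sign S (\<lambda>r. rd_rand R Oc r z) sk m) \<sigma> else 0) \<partial>M)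
                   / N)
              \<le> \<mu> n)))"

definition hf_no_abort :: "problem \<Rightarrow> 'c reduction \<Rightarrow> adversary \<Rightarrow> bool" where
  "hf_no_abort P R A \<longleftrightarrow> non_negligible (\<lambda>n. game_prob P R A n (no_abort R A n))"

text \<open>
  The conditional probability that the challenger accepts, given a valid forgery, is
  non-negligible; stated without division because a forgery may have probability 0.
\<close>

definition hf_finish :: "sigscheme \<Rightarrow> problem \<Rightarrow> 'c reduction \<Rightarrow> adversary \<Rightarrow> bool" where
  "hf_finish S P R A \<longleftrightarrow>
     (\<exists>\<delta>. non_negligible \<delta> \<and>
       (\<forall>n. game_prob P R A n
               (\<lambda>x \<rho> Oc. no_abort R A n x \<rho> Oc \<and> valid_forgery S R A n x \<rho> Oc \<and>
                         solves_problem P R A n x \<rho> Oc)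
            \<ge> \<delta> n * game_prob P R A n
               (\<lambda>x \<rho> Oc. no_abort R A n x \<rho> Oc \<and> valid_forgery S R A n x \<rho> Oc)))"

definition history_free :: "sigscheme \<Rightarrow> problem \<Rightarrow> 'c reduction \<Rightarrow> adversary \<Rightarrow> bool" where
  "history_free S P R A \<longleftrightarrow>
     hf_efficient P R A \<and> hf_instance S P R \<and> hf_rand S P R \<and> hf_sign S P R \<and>
     hf_no_abort P R A \<and> hf_finish S P R A"


section \<open>The reduction for Full Domain Hash\<close>

definition claw_reduction :: "tdp \<Rightarrow> tdp \<Rightarrow> (nat \<Rightarrow> nat) \<Rightarrow> (bits \<times> nat) reduction" where
  "claw_reduction F1 F2 p =
     \<lparr> rd_oc = (\<lambda>n pk. pair_pmf (pmf_of_set (tdp_dom F1 pk)) (pmf_of_set {1..p n})),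
       rd_enc = (\<lambda>(a, b). enc_nat b @ a),
       rd_start = (\<lambda>pk. (pk, pk)),
       rd_rand = (\<lambda>Oc r pk. case Oc r of (a, b) \<Rightarrow>
                     if b = 1 then tdp_eval F2 pk a else tdp_eval F1 pk a),
       rd_sign = (\<lambda>Oc m pk. case Oc m of (a, b) \<Rightarrow> if b \<noteq> 1 then Some a else None),
       rd_finish = (\<lambda>Oc m \<sigma> pk. case Oc m of (a, b) \<Rightarrow> [\<sigma>, a]),
       rd_instance = (\<lambda>pk. pk) \<rparr>"

end

theory Submission
  imports Defs
begin

text \<open>
  Given \<open>b\<close>, the hash value computed from \<open>O\<^sub>c(r) = (a, b)\<close> is uniform on the domain, because both
  \<open>f\<^sub>1\<close> and \<open>f\<^sub>2\<close> are permutations of it. So the simulated hash function is distributed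
  exactly like a random oracle, and the marks \<open>b = 1\<close> are independent of it. A run of the forger
  depends on the oracle at finitely many points only, and the event that it has a given transcript is
  a cylinder set, on which the probability of the marks factors out. Compared with the genuine attack,
  which does not see the marks, no signed message is marked with probability at least
  \<open>(1 - 1/p)\<^sup>q \<ge> 1 - q/p\<close>, which is at least \<open>1/2\<close> for \<open>p = 2 q + 1\<close>. A forged message is not signed,
  hence marked with conditional probability \<open>1/p\<close>, and then
  \<open>f\<^sub>1(\<sigma>) = O(m) = f\<^sub>2(a)\<close> is a claw.
\<close>

section \<open>Programs\<close>

text \<open>Adaptivity is the obstacle: which messages the forger gets signed, and on which one it
  forges, depends on the oracle, so independence of the coordinates does not apply to these points
  directly. Splitting by transcripts freezes them. Transcripts form a countable type, unlike oracles
  and stores, so the split is a countable sum and settles measurability as well. The two estimates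
  split different runs. An abort is answered by the empty string, so the simulated run reveals
  marks, and the bound \<open>q\<close> is assumed for genuine attacks only; hence the abort
  estimate splits the genuine attack and passes to the simulation afterwards. The forgery estimate
  can split the simulated run itself: its event already requires all signed messages to be unmarked,
  and only the mark at one unsigned point has to be free. The parameter \<open>p\<close> is pulled
  both ways: aborts are rare if it is large compared with \<open>q\<close>, but the success factor
  \<open>1/p\<close> and the unary length of \<open>b\<close> force it to be polynomially bounded.
  Hash values and signatures involve no asymptotics: their distances are exactly 0.\<close>

lemma exec_answer:
  assumes "exec \<Omega> P s t \<tau> s'" "(i, r, y) \<in> set \<tau>"
  shows "\<Omega> i r = y"
  using assms by (induction rule: exec.induct) auto

lemma exec_agree:
  assumes "exec \<Omega> P s t \<tau> s'" "\<And>i r y. (i, r, y) \<in> set \<tau> \<Longrightarrow> \<Omega>' i r = y"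
  shows "exec \<Omega>' P s t \<tau> s'"
  using assms
proof (induction rule: exec.induct)
  case (Skip s)
  show ?case using exec.Skip[of \<Omega>' s] .
next
  case (Push r b s)
  show ?case using exec.Push[of \<Omega>' r b s] .
next
  case (Pop r s)
  show ?case using exec.Pop[of \<Omega>' r s] .
next
  case (Copy r' r s)
  show ?case using exec.Copy[of \<Omega>' r' r s] .
next
  case (Ask i r r' s)
  have eq: "\<Omega>' i (s r) = \<Omega> i (s r)" by (rule Ask) simp
  show ?case using exec.Ask[of \<Omega>' i r r' s] unfolding eq .
next
  case (Seq P s t \<tau> s' Q t' \<tau>' s'')
  have "exec \<Omega>' P s t \<tau> s'" by (rule Seq.IH) (simp add: Seq.prems)
  moreover have "exec \<Omega>' Q s' t' \<tau>' s''" by (rule Seq.IH) (simp add: Seq.prems)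
  ultimately show ?case by (rule exec.Seq)
next
  case (CondT c s P t \<tau> s' Q)
  have "exec \<Omega>' P s t \<tau> s'" by (rule CondT.IH) (rule CondT.prems)
  with CondT.hyps(1) show ?case by (rule exec.CondT)
next
  case (CondF c s Q t \<tau> s' P)
  have "exec \<Omega>' Q s t \<tau> s'" by (rule CondF.IH) (rule CondF.prems)
  with CondF.hyps(1) show ?case by (rule exec.CondF)
next
  case (WhileF c s P)
  show ?case using exec.WhileF[OF WhileF.hyps] .
next
  case (WhileT c s P t \<tau> s' t' \<tau>' s'')
  have "exec \<Omega>' P s t \<tau> s'" by (rule WhileT.IH) (simp add: WhileT.prems)
  moreover have "exec \<Omega>' (While c P) s' t' \<tau>' s''" by (rule WhileT.IH) (simp add: WhileT.prems)
  ultimately show ?case using WhileT.hyps(1) by (intro exec.WhileT)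
qed

text \<open>A run sees its oracles only through the answers it records. For a fixed run, halting in
  the same way with another oracle is thus a finite list of conditions on that oracle.\<close>

lemma exec_agree_iff:
  assumes "exec \<Omega> P s t \<tau> s'"
  shows "exec \<Omega>' P s t \<tau> s' \<longleftrightarrow> (\<forall>(i, r, y) \<in> set \<tau>. \<Omega>' i r = y)"
proof
  assume e: "exec \<Omega>' P s t \<tau> s'"
  show "\<forall>(i, r, y) \<in> set \<tau>. \<Omega>' i r = y" by (clarify) (rule exec_answer[OF e])
next
  assume h: "\<forall>(i, r, y) \<in> set \<tau>. \<Omega>' i r = y"
  show "exec \<Omega>' P s t \<tau> s'"
  proof (rule exec_agree[OF assms])
    fix i r y assume "(i, r, y) \<in> set \<tau>"
    from bspec[OF h this] show "\<Omega>' i r = y" by simp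
  qed
qed

lemma exec_ask_free:
  assumes "exec \<Omega> P s t \<tau> s'" "ask_free P"
  shows "\<tau> = []"
  using assms by (induction rule: exec.induct) auto

text \<open>Evaluation programs are specified with \<open>no_oracles\<close> but are run inside
  \<open>hash_prog\<close>, where the oracle of the reduction is present.\<close>

lemma exec_ask_free_cong:
  assumes "exec \<Omega> P s t \<tau> s'" "ask_free P"
  shows "exec \<Omega>' P s t [] s'"
proof -
  have "exec \<Omega>' P s t \<tau> s'" by (rule exec_agree[OF assms(1)]) (simp add: exec_ask_free[OF assms])
  then show ?thesis by (simp only: exec_ask_free[OF assms])
qed

text \<open>Copies and queries are charged for the bits they move, so no register outgrows the
  longest one by more than the time spent. The bound \<open>M\<close> is common to all registers,
  since \<open>Copy\<close> may move long contents into a short register.\<close>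

lemma exec_store_length:
  assumes "exec \<Omega> P s t \<tau> s'" "\<And>r. length (s r) \<le> M"
  shows "length (s' r) \<le> M + t"
  using assms
proof (induction arbitrary: M r rule: exec.induct)
  case (Skip s)
  show ?case using Skip[of r] by simp
next
  case (Push x b s)
  show ?case using Push[of r] Push[of x] by simp
next
  case (Pop x s)
  show ?case using Pop[of r] Pop[of x] by auto
next
  case (Copy x' x s)
  show ?case using Copy[of r] Copy[of x] by simp
next
  case (Ask i x x' s)
  show ?case using Ask[of r] Ask[of x] by simp
next
  case (Seq P s t \<tau> s' Q t' \<tau>' s'')
  have "length (s'' r) \<le> (M + t) + t'" by (intro Seq.IH Seq.prems)
  then show ?case by simp
next
  case (CondT c s P t \<tau> s' Q)
  have "length (s' r) \<le> M + t" by (intro CondT.IH CondT.prems)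
  then show ?case by simp
next
  case (CondF c s Q t \<tau> s' P)
  have "length (s' r) \<le> M + t" by (intro CondF.IH CondF.prems)
  then show ?case by simp
next
  case (WhileF c s P)
  show ?case using WhileF.prems[of r] by simp
next
  case (WhileT c s P t \<tau> s' t' \<tau>' s'')
  have "length (s'' r) \<le> (M + t) + t'" by (intro WhileT.IH WhileT.prems)
  then show ?case by simp
qed

lemma exec_transcript_length:
  assumes "exec \<Omega> P s t \<tau> s'"
  shows "length \<tau> \<le> t"
  using assms by (induction rule: exec.induct) auto

lemma exec_query_length:
  assumes "exec \<Omega> P s t \<tau> s'" "(i, r, y) \<in> set \<tau>"
  shows "length r \<le> t"
  using assms by (induction rule: exec.induct) (auto simp: trans_le_add1 trans_le_add2)

section \<open>Runs and their transcripts\<close>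

lemma run_eq:
  assumes "exec \<Omega> P (init_store ins) t \<tau> s"
  shows "run \<Omega> P ins = (t, \<tau>, s)"
  unfolding run_def
proof (rule the_equality)
  show "case (t, \<tau>, s) of (t, \<tau>, s) \<Rightarrow> exec \<Omega> P (init_store ins) t \<tau> s" using assms by simp
next
  fix r :: "nat \<times> transcript \<times> store"
  assume r: "case r of (t, \<tau>, s) \<Rightarrow> exec \<Omega> P (init_store ins) t \<tau> s"
  obtain u \<upsilon> s' where u: "r = (u, \<upsilon>, s')" by (cases r)
  then have "exec \<Omega> P (init_store ins) u \<upsilon> s'" using r by simp
  from exec_deterministic[OF assms this] show "r = (t, \<tau>, s)" by (simp only: u simp_thms)
qed

lemma steps_eq:
  assumes "exec \<Omega> P (init_store ins) t \<tau> s"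
  shows "steps \<Omega> P ins = t"
  by (simp add: steps_def run_eq[OF assms])

text \<open>Keeps only the transcript, a value of a countable type; stores are functions, and their
  type is not countable. \<open>None\<close> records that the run does not halt, where
  \<open>run\<close> is unspecified.\<close>

definition trace :: "oracles \<Rightarrow> prog \<Rightarrow> bits list \<Rightarrow> transcript option" where
  "trace \<Omega> P ins =
     (if \<exists>t \<tau> s. exec \<Omega> P (init_store ins) t \<tau> s then Some (fst (snd (run \<Omega> P ins))) else None)"

lemma trace_eq_Some_iff:
  "trace \<Omega> P ins = Some \<tau> \<longleftrightarrow> (\<exists>t s. exec \<Omega> P (init_store ins) t \<tau> s)"
proof (cases "\<exists>t \<tau> s. exec \<Omega> P (init_store ins) t \<tau> s")
  case True
  then obtain t \<tau>' s where e: "exec \<Omega> P (init_store ins) t \<tau>' s" by blast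
  have "trace \<Omega> P ins = Some \<tau>'" using True by (simp add: trace_def run_eq[OF e])
  with e exec_deterministic[OF e] show ?thesis by (metis option.inject)
next
  case False
  then show ?thesis by (simp add: trace_def)
qed

lemma trace_agree_iff:
  assumes "trace \<Omega> P ins = Some \<tau>"
  shows "trace \<Omega>' P ins = Some \<tau> \<longleftrightarrow> (\<forall>(i, r, y) \<in> set \<tau>. \<Omega>' i r = y)"
proof -
  obtain t s where e: "exec \<Omega> P (init_store ins) t \<tau> s" using assms trace_eq_Some_iff by blast
  show ?thesis
  proof
    assume "trace \<Omega>' P ins = Some \<tau>"
    then obtain u s' where e': "exec \<Omega>' P (init_store ins) u \<tau> s'" using trace_eq_Some_iff by blast
    show "\<forall>(i, r, y) \<in> set \<tau>. \<Omega>' i r = y" using exec_answer[OF e'] by blast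
  next
    assume "\<forall>(i, r, y) \<in> set \<tau>. \<Omega>' i r = y"
    then have "exec \<Omega>' P (init_store ins) t \<tau> s" by (simp only: exec_agree_iff[OF e])
    then show "trace \<Omega>' P ins = Some \<tau>" using trace_eq_Some_iff by blast
  qed
qed

text \<open>A transcript contains all answers on which the run depends, so it determines time and
  final store as well. For runs that do not halt, both sides are the same unspecified value.\<close>

lemma run_eq_of_trace_eq:
  assumes "trace \<Omega> P ins = trace \<Omega>' P ins"
  shows "run \<Omega> P ins = run \<Omega>' P ins"
proof (cases "trace \<Omega> P ins")
  case None
  have no: "\<nexists>t \<tau> s. exec \<Omega> P (init_store ins) t \<tau> s" if "trace \<Omega> P ins = None" for \<Omega>
    using that trace_eq_Some_iff by (metis option.distinct(1))
  have "run \<Omega> P ins = (THE r. False)" if "trace \<Omega> P ins = None" for \<Omega>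
    unfolding run_def using no[OF that] by (intro arg_cong[where f = The] ext) (simp split: prod.splits)
  with None assms show ?thesis by metis
next
  case (Some \<tau>)
  then have "trace \<Omega>' P ins = Some \<tau>" using assms by simp
  then have agree: "\<forall>(i, r, y) \<in> set \<tau>. \<Omega>' i r = y" by (simp only: trace_agree_iff[OF Some])
  obtain t s where e: "exec \<Omega> P (init_store ins) t \<tau> s" using Some trace_eq_Some_iff by blast
  have "exec \<Omega>' P (init_store ins) t \<tau> s" using agree by (simp only: exec_agree_iff[OF e])
  from run_eq[OF this] show ?thesis by (simp only: run_eq[OF e])
qed

lemma trace_run:
  assumes "trace \<Omega> P ins = Some \<tau>"
  shows "fst (snd (run \<Omega> P ins)) = \<tau>"
proof -
  obtain t s where "exec \<Omega> P (init_store ins) t \<tau> s" using assms trace_eq_Some_iff by blast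
  from run_eq[OF this] show ?thesis by simp
qed

text \<open>The choice of the oracles is immaterial by \<open>run_eq_of_trace_eq\<close>.\<close>

definition run_of_trace :: "prog \<Rightarrow> bits list \<Rightarrow> transcript option \<Rightarrow> nat \<times> transcript \<times> store" where
  "run_of_trace P ins k = run (SOME \<Omega>. trace \<Omega> P ins = k) P ins"

lemma run_of_trace: "run_of_trace P ins (trace \<Omega> P ins) = run \<Omega> P ins"
  unfolding run_of_trace_def
  by (rule run_eq_of_trace_eq) (rule someI[where P = "\<lambda>\<Omega>'. trace \<Omega>' P ins = trace \<Omega> P ins", OF refl])


section \<open>Polynomial bounds\<close>

lemma poly_mono_nat:
  fixes p :: "nat poly"
  assumes "x \<le> y"
  shows "poly p x \<le> poly p y"
proof (induction p)
  case (pCons a p)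
  then have "x * poly p x \<le> y * poly p y" using assms by (intro mult_le_mono)
  then show ?case by simp
qed simp

lemma poly_nat_le_power:
  fixes p :: "nat poly"
  shows "\<exists>c. \<forall>\<^sub>F n in sequentially. poly p n \<le> n ^ c"
proof (induction p)
  case 0
  show ?case by simp
next
  case (pCons a p)
  then obtain c where c: "\<forall>\<^sub>F n in sequentially. poly p n \<le> n ^ c" by blast
  have "\<forall>\<^sub>F n::nat in sequentially. n \<ge> a + 1" by (rule eventually_ge_at_top)
  with c have "\<forall>\<^sub>F n in sequentially. poly (pCons a p) n \<le> n ^ (c + 2)"
  proof eventually_elim
    case (elim n)
    \<comment> \<open>One factor \<open>n\<close> absorbs the shift by \<open>pCons\<close>, a
      second one absorbs the coefficient \<open>a + 1\<close>; hence the exponent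
      \<open>c + 2\<close>.\<close>
    have "1 \<le> n ^ (c + 1)" using elim(2) by simp
    then have "a \<le> a * n ^ (c + 1)" by simp
    moreover have "n * poly p n \<le> n ^ (c + 1)" using elim(1) by simp
    ultimately have "a + n * poly p n \<le> (a + 1) * n ^ (c + 1)" by (simp only: distrib_right mult_1 add_mono)
    also have "\<dots> \<le> n * n ^ (c + 1)" using elim(2) by (intro mult_right_mono) auto
    finally show ?case by simp
  qed
  then show ?case by blast
qed

lemma non_negligible_inverse_poly:
  fixes p :: "nat poly"
  assumes "\<And>n. poly p n \<ge> 1"
  shows "non_negligible (\<lambda>n. 1 / real (poly p n))"
proof -
  obtain c where c: "\<forall>\<^sub>F n in sequentially. poly p n \<le> n ^ c" using poly_nat_le_power by blast
  have "\<forall>\<^sub>F n in sequentially. 1 / real (poly p n) \<ge> 1 / real n ^ c"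
    using c
  proof eventually_elim
    case (elim n)
    have "real (poly p n) \<le> real n ^ c" using elim by (metis of_nat_le_iff of_nat_power)
    moreover have "real (poly p n) > 0" using assms[of n] by simp
    ultimately show ?case by (simp add: frac_le)
  qed
  then show ?thesis by (auto simp: non_negligible_def)
qed

lemma solves_in_poly_time_exec:
  assumes "solves_in_poly_time P J"
  obtains T :: "nat poly" where
    "\<And>\<Omega> ins outs L. (\<Omega>, ins, outs) \<in> J \<Longrightarrow> (\<And>i r. length (\<Omega> i r) \<le> L) \<Longrightarrow>
       \<exists>t \<tau> s. exec \<Omega> P (init_store ins) t \<tau> s \<and> map s [0..<length outs] = outs \<and>
         t \<le> poly T ((\<Sum>x\<leftarrow>ins. length x) + L)"
proof -
  obtain T :: "nat poly" where T: "\<forall>(\<Omega>, ins, outs) \<in> J. \<forall>L. (\<forall>i r. length (\<Omega> i r) \<le> L) \<longrightarrow>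
      (\<exists>t \<tau> s. exec \<Omega> P (init_store ins) t \<tau> s \<and> map s [0..<length outs] = outs \<and>
         t \<le> poly T ((\<Sum>x\<leftarrow>ins. length x) + L))"
    using assms unfolding solves_in_poly_time_def by (elim exE)
  show thesis
  proof (rule that)
    fix \<Omega> :: oracles and ins outs :: "bits list" and L
    assume "(\<Omega>, ins, outs) \<in> J" and L: "\<And>i r. length (\<Omega> i r) \<le> L"
    from bspec[OF T this(1)] L
    show "\<exists>t \<tau> s. exec \<Omega> P (init_store ins) t \<tau> s \<and> map s [0..<length outs] = outs \<and>
         t \<le> poly T ((\<Sum>x\<leftarrow>ins. length x) + L)"
      by (simp only: prod.case simp_thms)
  qed
qed

section \<open>The programs of the reduction\<close>

lemma init_store_simps:
  "init_store [a, b] = (\<lambda>_. [])(0 := a, 1 := b)"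
  "init_store [a, b, c] = (\<lambda>_. [])(0 := a, 1 := b, 2 := c)"
  "init_store [a, b, c, d] = (\<lambda>_. [])(0 := a, 1 := b, 2 := c, 3 := d)"
  by (auto simp: init_store_def fun_eq_iff less_Suc_eq numeral_2_eq_2 numeral_3_eq_3)

text \<open>\<open>enc_nat b\<close> is a block of \<open>True\<close> closed by
  \<open>False\<close>: the loop removes the block, the last \<open>Pop\<close> the
  separator.\<close>

definition skip_nat :: "nat \<Rightarrow> prog" where
  "skip_nat r = Seq (While (Head r) (Pop r)) (Pop r)"

lemma exec_skip_while:
  assumes "s r = enc_nat b @ a"
  shows "exec \<Omega> (While (Head r) (Pop r)) s (2 * b + 1) [] (s(r := False # a))"
  using assms
proof (induction b arbitrary: s)
  case 0
  then have "s(r := False # a) = s" by (auto simp: enc_nat_def)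
  with 0 show ?case using exec.WhileF[of "Head r" s \<Omega> "Pop r"] by (simp add: enc_nat_def)
next
  case (Suc b)
  have "exec \<Omega> (While (Head r) (Pop r)) s (1 + 1 + (2 * b + 1)) ([] @ [])
      ((s(r := tl (s r)))(r := False # a))"
    by (rule exec.WhileT[OF _ exec.Pop]; (rule Suc.IH)?) (use Suc.prems in \<open>auto simp: enc_nat_def\<close>)
  then have "exec \<Omega> (While (Head r) (Pop r)) s (2 * Suc b + 1) [] (s(r := False # a))" by simp
  then show ?case .
qed

lemma exec_skip_nat:
  assumes "s r = enc_nat b @ a"
  shows "exec \<Omega> (skip_nat r) s (2 * b + 2) [] (s(r := a))"
proof -
  let ?s = "s(r := False # a)"
  have "exec \<Omega> (While (Head r) (Pop r)) s (2 * b + 1) [] ?s" by (rule exec_skip_while) (rule assms)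
  moreover have "exec \<Omega> (Pop r) ?s 1 [] (s(r := a))" using exec.Pop[of \<Omega> r ?s] by simp
  ultimately have "exec \<Omega> (skip_nat r) s (2 * b + 1 + 1) ([] @ []) (s(r := a))"
    unfolding skip_nat_def by (rule exec.Seq)
  then show ?thesis by simp
qed

definition hash_prog :: "prog \<Rightarrow> prog \<Rightarrow> prog" where
  "hash_prog P1 P2 =
     (let move = Seq (skip_nat 3) (Seq (Copy 2 3) (Copy 3 4))
      in Seq (Seq (Ask 0 1 3) (Seq (Copy 1 2) (Pop 3)))
           (Cond (Head 3) (Seq move P1) (Seq move P2)))"

lemma exec_hash_prog:
  fixes a pk w x :: bits
  assumes P: "exec \<Omega> (if b = 1 then P2 else P1) (init_store [w, pk, a]) t \<tau> s'"
    and ans: "\<Omega> 0 x = enc_nat b @ a" and b: "b \<ge> 1"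
  shows "\<exists>u \<upsilon>. exec \<Omega> (hash_prog P1 P2) (init_store [w, x, pk]) u \<upsilon> s' \<and>
           u \<le> 20 + length x + length pk + 4 * length (\<Omega> 0 x) + t"
proof -
  \<comment> \<open>What is left of the mark after the first \<open>Pop\<close>.\<close>
  define c where "c = b - 1"
  have bc: "b = Suc c" using b by (simp add: c_def)
  let ?move = "Seq (skip_nat 3) (Seq (Copy 2 3) (Copy 3 4))"
  let ?s = "init_store [w, x, pk]"
  let ?s1 = "(\<lambda>_::nat. [])(0 := w, 1 := pk, 2 := pk, 3 := enc_nat c @ a)"
  let ?s2 = "(\<lambda>_::nat. [])(0 := w, 1 := pk, 2 := pk, 3 := a)"
  let ?s3 = "(\<lambda>_::nat. [])(0 := w, 1 := pk, 2 := a, 3 := a)"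
  have A: "exec \<Omega> (Ask 0 1 3) ?s (1 + length x + length (\<Omega> 0 x)) [(0, x, \<Omega> 0 x)] (?s(3 := \<Omega> 0 x))"
    using exec.Ask[of \<Omega> 0 1 3 ?s] by (simp add: init_store_simps)
  have B: "exec \<Omega> (Copy 1 2) (?s(3 := \<Omega> 0 x)) (1 + length pk) [] (?s(3 := \<Omega> 0 x, 1 := pk))"
    using exec.Copy[of \<Omega> 1 2 "?s(3 := \<Omega> 0 x)"] by (simp add: init_store_simps)
  have "(?s(3 := \<Omega> 0 x, 1 := pk))(3 := tl ((?s(3 := \<Omega> 0 x, 1 := pk)) 3)) = ?s1"
    unfolding init_store_simps by (auto simp: fun_eq_iff ans bc enc_nat_def)
  then have C: "exec \<Omega> (Pop 3) (?s(3 := \<Omega> 0 x, 1 := pk)) 1 [] ?s1"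
    using exec.Pop[of \<Omega> 3 "?s(3 := \<Omega> 0 x, 1 := pk)"] by metis
  have D: "exec \<Omega> (skip_nat 3) ?s1 (2 * c + 2) [] ?s2"
    using exec_skip_nat[of ?s1 3 c a] by simp
  have E: "exec \<Omega> (Copy 2 3) ?s2 (1 + length a) [] ?s3"
    using exec.Copy[of \<Omega> 2 3 ?s2] by (simp add: fun_upd_twist)
  have "?s3(3 := ?s3 4) = init_store [w, pk, a]" by (simp add: init_store_simps fun_eq_iff)
  then have F: "exec \<Omega> (Copy 3 4) ?s3 1 [] (init_store [w, pk, a])"
    using exec.Copy[of \<Omega> 3 4 ?s3] by simp
  note move = exec.Seq[OF D exec.Seq[OF E F]]
  have h: "holds (Head 3) ?s1 \<longleftrightarrow> b \<noteq> 1" by (cases c) (auto simp: bc enc_nat_def)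
  let ?u = "2 * c + 2 + (1 + length a + 1)"
  have "exec \<Omega> (Cond (Head 3) (Seq ?move P1) (Seq ?move P2)) ?s1 (1 + (?u + t)) ([] @ [] @ [] @ \<tau>) s'"
  proof (cases "b = 1")
    case True
    then show ?thesis using exec.CondF[OF _ exec.Seq[OF move]] P h by simp
  next
    case False
    then show ?thesis using exec.CondT[OF _ exec.Seq[OF move]] P h by simp
  qed
  note G = exec.Seq[OF exec.Seq[OF A exec.Seq[OF B C]] this]
  have "length (\<Omega> 0 x) = b + 1 + length a" by (simp add: ans enc_nat_def)
  then have "1 + length x + length (\<Omega> 0 x) + (1 + length pk + 1) + (1 + (?u + t))
      \<le> 20 + length x + length pk + 4 * length (\<Omega> 0 x) + t" by (simp add: bc)
  with G show ?thesis unfolding hash_prog_def Let_def by blast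
qed

text \<open>The test for \<open>b = 1\<close> is that of \<open>hash_prog\<close>.
  \<open>Copy 0 5\<close> empties register 0, register 5 being empty, and the pushed bit is the tag
  of \<open>enc_opt\<close>.\<close>

definition sign_prog :: prog where
  "sign_prog =
     Seq (Seq (Ask 0 1 0) (Pop 0))
       (Cond (Head 0) (Seq (skip_nat 0) (Push 0 True)) (Seq (Copy 0 5) (Push 0 False)))"

lemma exec_sign_prog:
  fixes a pk w x :: bits
  assumes ans: "\<Omega> 0 x = enc_nat b @ a" and b: "b \<ge> 1"
  shows "\<exists>u \<upsilon> s. exec \<Omega> sign_prog (init_store [w, x, pk]) u \<upsilon> s \<and>
           s 0 = enc_opt (if b \<noteq> 1 then Some a else None) \<and> u \<le> 20 + length x + 4 * length (\<Omega> 0 x)"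
proof -
  define c where "c = b - 1"
  have bc: "b = Suc c" using b by (simp add: c_def)
  let ?s = "init_store [w, x, pk]"
  let ?s1 = "?s(0 := enc_nat c @ a)"
  have A: "exec \<Omega> (Ask 0 1 0) ?s (1 + length x + length (\<Omega> 0 x)) [(0, x, \<Omega> 0 x)] (?s(0 := \<Omega> 0 x))"
    using exec.Ask[of \<Omega> 0 1 0 ?s] by (simp add: init_store_simps)
  have B: "exec \<Omega> (Pop 0) (?s(0 := \<Omega> 0 x)) 1 [] ?s1"
    using exec.Pop[of \<Omega> 0 "?s(0 := \<Omega> 0 x)"] by (simp add: ans bc enc_nat_def)
  have h: "holds (Head 0) ?s1 \<longleftrightarrow> b \<noteq> 1" by (cases c) (auto simp: bc enc_nat_def)
  have l: "length (\<Omega> 0 x) = b + 1 + length a" by (simp add: ans enc_nat_def)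
  show ?thesis
  proof (cases "b = 1")
    case True
    have C: "exec \<Omega> (Copy 0 5) ?s1 1 [] (?s(0 := []))"
      using exec.Copy[of \<Omega> 0 5 ?s1] by (simp add: init_store_simps)
    have D: "exec \<Omega> (Push 0 False) (?s(0 := [])) 1 [] (?s(0 := [False]))"
      using exec.Push[of \<Omega> 0 False "?s(0 := [])"] by simp
    show ?thesis unfolding sign_prog_def
      by (intro exI conjI, rule exec.Seq[OF exec.Seq[OF A B] exec.CondF[OF _ exec.Seq[OF C D]]])
        (use True h l in auto)
  next
    case False
    have C: "exec \<Omega> (skip_nat 0) ?s1 (2 * c + 2) [] (?s(0 := a))"
      using exec_skip_nat[of ?s1 0 c a] by simp
    have D: "exec \<Omega> (Push 0 True) (?s(0 := a)) 1 [] (?s(0 := True # a))"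
      using exec.Push[of \<Omega> 0 True "?s(0 := a)"] by simp
    show ?thesis unfolding sign_prog_def
      by (intro exI conjI, rule exec.Seq[OF exec.Seq[OF A B] exec.CondT[OF _ exec.Seq[OF C D]]])
        (use False h l bc in auto)
  qed
qed

definition finish_prog :: prog where
  "finish_prog = Seq (Ask 0 1 1) (Seq (Copy 0 2) (skip_nat 1))"

lemma exec_finish_prog:
  fixes a pk w x y :: bits
  assumes ans: "\<Omega> 0 x = enc_nat b @ a"
  shows "\<exists>u \<upsilon> s. exec \<Omega> finish_prog (init_store [w, x, y, pk]) u \<upsilon> s \<and>
           s 0 = y \<and> s 1 = a \<and> u \<le> 20 + length x + length y + 4 * length (\<Omega> 0 x)"
proof -
  let ?s = "init_store [w, x, y, pk]"
  have A: "exec \<Omega> (Ask 0 1 1) ?s (1 + length x + length (\<Omega> 0 x)) [(0, x, \<Omega> 0 x)] (?s(1 := \<Omega> 0 x))"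
    using exec.Ask[of \<Omega> 0 1 1 ?s] by (simp add: init_store_simps)
  have B: "exec \<Omega> (Copy 0 2) (?s(1 := \<Omega> 0 x)) (1 + length y) [] (?s(1 := \<Omega> 0 x, 0 := y))"
    using exec.Copy[of \<Omega> 0 2 "?s(1 := \<Omega> 0 x)"] by (simp add: init_store_simps)
  have C: "exec \<Omega> (skip_nat 1) (?s(1 := \<Omega> 0 x, 0 := y)) (2 * b + 2) [] (?s(1 := \<Omega> 0 x, 0 := y, 1 := a))"
    by (rule exec_skip_nat) (simp add: ans)
  have l: "length (\<Omega> 0 x) = b + 1 + length a" by (simp add: ans enc_nat_def)
  show ?thesis unfolding finish_prog_def
    by (intro exI conjI, rule exec.Seq[OF A exec.Seq[OF B C]]) (use l in auto)
qed


section \<open>Random oracles\<close>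

lemma space_random_oracle [simp]: "space (random_oracle d) = UNIV"
  by (simp add: random_oracle_def space_PiM)

lemma prob_space_random_oracle: "prob_space (random_oracle d)"
  unfolding random_oracle_def by (rule prob_space_PiM) (rule measure_pmf.prob_space_axioms)

lemma measurable_query [measurable]:
  "(\<lambda>Oc. Oc r) \<in> measurable (random_oracle d) (count_space UNIV)"
proof -
  have "(\<lambda>Oc. Oc r) \<in> measurable (random_oracle d) (measure_pmf d)"
    unfolding random_oracle_def by (rule measurable_component_singleton) simp
  then show ?thesis by simp
qed

lemma measurable_query_compose:
  "(\<lambda>Oc. g (Oc r)) \<in> measurable (random_oracle d) (count_space UNIV)"
  by (rule measurable_compose[OF measurable_query]) simp

lemma measurable_map_oracle:
  "(\<lambda>Oc r. g (Oc r)) \<in> measurable (random_oracle d) (random_oracle (map_pmf g d))"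
  unfolding random_oracle_def[of "map_pmf g d"]
proof (rule measurable_PiM_single')
  show "(\<lambda>Oc. g (Oc r)) \<in> measurable (random_oracle d) (measure_pmf (map_pmf g d))" for r
    using measurable_query_compose[of g r d] by simp
qed simp

lemma measure_random_oracle_cylinder:
  assumes "finite J"
  shows "measure (random_oracle d) {Oc. \<forall>r \<in> J. Oc r \<in> A r} = (\<Prod>r\<in>J. measure_pmf.prob d (A r))"
proof -
  interpret product_prob_space "\<lambda>_. measure_pmf d" "UNIV :: bits set" ..
  have "{Oc. \<forall>r \<in> J. Oc r \<in> A r} = prod_emb UNIV (\<lambda>_. measure_pmf d) J (Pi\<^sub>E J A)"
    by (auto simp: prod_emb_def space_PiM PiE_def Pi_def)
  then show ?thesis
    unfolding random_oracle_def using measure_PiM_emb[of J A] assms by simp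
qed

text \<open>Each coordinate lies in the support almost surely, and there are only countably many
  coordinates.\<close>

lemma AE_random_oracle_support: "AE Oc in random_oracle d. \<forall>r. Oc r \<in> set_pmf d"
  unfolding AE_all_countable random_oracle_def
  by (intro allI AE_PiM_component measure_pmf.prob_space_axioms) (auto simp: AE_measure_pmf)

text \<open>A product measure is determined by its values on finite cylinders, and the preimage of
  such a cylinder under a coordinatewise map is one again. This yields the law of the simulated hash
  function.\<close>

lemma distr_random_oracle_map:
  "distr (random_oracle d) (random_oracle (map_pmf g d)) (\<lambda>Oc r. g (Oc r)) = random_oracle (map_pmf g d)"
proof -
  interpret product_prob_space "\<lambda>_. measure_pmf (map_pmf g d)" "UNIV :: bits set" ..
  show ?thesis
    unfolding random_oracle_def[of "map_pmf g d"]
  proof (rule PiM_eq)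
    fix J :: "bits set" and F
    assume J: "finite J"
    have S: "prod_emb UNIV (\<lambda>_. measure_pmf (map_pmf g d)) J (Pi\<^sub>E J F) \<in> sets (random_oracle (map_pmf g d))"
      unfolding random_oracle_def by (rule sets_PiM_I) (use J in auto)
    have "emeasure (distr (random_oracle d) (random_oracle (map_pmf g d)) (\<lambda>Oc r. g (Oc r)))
        (prod_emb UNIV (\<lambda>_. measure_pmf (map_pmf g d)) J (Pi\<^sub>E J F))
      = emeasure (random_oracle d) {Oc. \<forall>r \<in> J. Oc r \<in> g -` F r}"
      unfolding emeasure_distr[OF measurable_map_oracle S]
      by (rule arg_cong2[where f = emeasure]) (auto simp: prod_emb_def PiE_def Pi_def)
    also have "\<dots> = ennreal (\<Prod>r\<in>J. measure_pmf.prob d (g -` F r))"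
      using prob_space_random_oracle[of d] measure_random_oracle_cylinder[OF J, of d "\<lambda>r. g -` F r"]
      by (simp add: finite_measure.emeasure_eq_measure prob_space.finite_measure)
    also have "\<dots> = (\<Prod>r\<in>J. emeasure (measure_pmf (map_pmf g d)) (F r))"
      by (simp add: measure_pmf.emeasure_eq_measure prod_ennreal)
    finally show "emeasure (distr (random_oracle d) (Pi\<^sub>M UNIV (\<lambda>_. measure_pmf (map_pmf g d))) (\<lambda>Oc r. g (Oc r)))
        (prod_emb UNIV (\<lambda>_. measure_pmf (map_pmf g d)) J (Pi\<^sub>E J F))
        = (\<Prod>r\<in>J. emeasure (measure_pmf (map_pmf g d)) (F r))"
      by (simp add: random_oracle_def)
  qed (simp add: random_oracle_def)
qed

text \<open>Coordinates are independent, so requiring \<open>W\<close> in addition loses no more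
  than a factor \<open>c\<close> for each point of \<open>K\<close>. It is applied to the signed
  messages with \<open>c = 1 - 1/k\<close>, and to the forged message with
  \<open>c = 1/k\<close>.\<close>

lemma measure_cylinder_restrict_ge:
  assumes "finite J" "K \<subseteq> J" "0 \<le> c"
    and W: "\<And>r. r \<in> K \<Longrightarrow> c * measure_pmf.prob d (A r) \<le> measure_pmf.prob d (A r \<inter> W)"
  shows "c ^ card K * measure (random_oracle d) {Oc. \<forall>r \<in> J. Oc r \<in> A r}
    \<le> measure (random_oracle d) {Oc. \<forall>r \<in> J. Oc r \<in> A r \<and> (r \<in> K \<longrightarrow> Oc r \<in> W)}"
proof -
  have "c ^ card K = (\<Prod>r\<in>J. if r \<in> K then c else 1)"
    using assms(1,2) by (simp add: prod.If_cases Int_absorb1)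
  then have "c ^ card K * measure (random_oracle d) {Oc. \<forall>r \<in> J. Oc r \<in> A r}
      = (\<Prod>r\<in>J. (if r \<in> K then c else 1) * measure_pmf.prob d (A r))"
    by (simp add: measure_random_oracle_cylinder[OF assms(1)] prod.distrib)
  also have "\<dots> \<le> (\<Prod>r\<in>J. measure_pmf.prob d (A r \<inter> (if r \<in> K then W else UNIV)))"
    using W assms(3) by (intro prod_mono) auto
  also have "\<dots> = measure (random_oracle d) {Oc. \<forall>r \<in> J. Oc r \<in> A r \<inter> (if r \<in> K then W else UNIV)}"
    by (rule measure_random_oracle_cylinder[OF assms(1), symmetric])
  also have "{Oc. \<forall>r \<in> J. Oc r \<in> A r \<inter> (if r \<in> K then W else UNIV)}
      = {Oc. \<forall>r \<in> J. Oc r \<in> A r \<and> (r \<in> K \<longrightarrow> Oc r \<in> W)}"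
    by auto
  finally show ?thesis .
qed

section \<open>Total probability over a countable case distinction\<close>

lemma (in finite_measure) emeasure_countable_cases:
  fixes h :: "'a \<Rightarrow> 'k::countable"
  assumes h [measurable]: "h \<in> measurable M (count_space UNIV)"
    and A [measurable]: "\<And>k. Measurable.pred M (A k)"
  shows "emeasure M {x \<in> space M. A (h x) x}
    = (\<integral>\<^sup>+k. emeasure M {x \<in> space M. h x = k \<and> A k x} \<partial>count_space UNIV)"
proof -
  have "{x \<in> space M. A (h x) x} = (\<Union>k. {x \<in> space M. h x = k \<and> A k x})" by auto
  then show ?thesis
    using emeasure_UN_countable[of UNIV "\<lambda>k. {x \<in> space M. h x = k \<and> A k x}" M]
    by (auto simp: disjoint_family_on_def)
qed

text \<open>The two events can be compared separately for each value of \<open>h\<close>, which will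
  be the transcript of a run. Passing to extended values avoids convergence questions for the
  sum.\<close>

lemma (in finite_measure) measure_countable_cases_ge:
  fixes h :: "'a \<Rightarrow> 'k::countable"
  assumes h [measurable]: "h \<in> measurable M (count_space UNIV)"
    and A [measurable]: "\<And>k. Measurable.pred M (A k)"
    and B [measurable]: "\<And>k. Measurable.pred M (B k)"
    and c: "0 \<le> c"
    and le: "\<And>k. c * measure M {x \<in> space M. h x = k \<and> B k x} \<le> measure M {x \<in> space M. h x = k \<and> A k x}"
  shows "c * measure M {x \<in> space M. B (h x) x} \<le> measure M {x \<in> space M. A (h x) x}"
proof -
  have "ennreal c * emeasure M {x \<in> space M. B (h x) x}
      = (\<integral>\<^sup>+k. ennreal c * emeasure M {x \<in> space M. h x = k \<and> B k x} \<partial>count_space UNIV)"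
    by (subst emeasure_countable_cases[OF h B]) (rule nn_integral_cmult[symmetric], simp)
  also have "\<dots> \<le> (\<integral>\<^sup>+k. emeasure M {x \<in> space M. h x = k \<and> A k x} \<partial>count_space UNIV)"
    using le c by (intro nn_integral_mono) (simp add: emeasure_eq_measure ennreal_mult'[symmetric] ennreal_leI)
  also have "\<dots> = emeasure M {x \<in> space M. A (h x) x}"
    by (rule emeasure_countable_cases[OF h A, symmetric])
  finally show ?thesis
    using c by (simp add: emeasure_eq_measure ennreal_mult'[symmetric])
qed


section \<open>Measurability of runs\<close>

text \<open>A transcript that occurs for some oracle is a finite condition on the oracle by
  \<open>trace_agree_iff\<close>; one that never occurs gives the empty set. Not halting is the
  complement of a countable union of these sets.\<close>

lemma measurable_trace:
  assumes [measurable]: "\<And>i r. (\<lambda>\<omega>. \<Omega> \<omega> i r) \<in> measurable M (count_space UNIV)"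
  shows "(\<lambda>\<omega>. trace (\<Omega> \<omega>) P ins) \<in> measurable M (count_space UNIV)"
proof -
  have S: "{\<omega> \<in> space M. trace (\<Omega> \<omega>) P ins = Some \<tau>} \<in> sets M" for \<tau>
  proof (cases "\<exists>\<Omega>'. trace \<Omega>' P ins = Some \<tau>")
    case True
    then obtain \<Omega>' where t: "trace \<Omega>' P ins = Some \<tau>" by blast
    have "Measurable.pred M (\<lambda>\<omega>. \<forall>x \<in> set \<tau>. \<Omega> \<omega> (fst x) (fst (snd x)) = snd (snd x))"
      by measurable
    then show ?thesis
      by (simp add: trace_agree_iff[OF t] case_prod_unfold pred_def)
  next
    case False
    then have "{\<omega> \<in> space M. trace (\<Omega> \<omega>) P ins = Some \<tau>} = {}" by blast
    then show ?thesis by (metis sets.empty_sets)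
  qed
  have "(\<lambda>\<omega>. trace (\<Omega> \<omega>) P ins) -` {k} \<inter> space M \<in> sets M" for k
  proof (cases k)
    case None
    have "(\<lambda>\<omega>. trace (\<Omega> \<omega>) P ins) -` {None} \<inter> space M
        = space M - (\<Union>\<tau>. {\<omega> \<in> space M. trace (\<Omega> \<omega>) P ins = Some \<tau>})"
      by auto
    also have "\<dots> \<in> sets M" using S by blast
    finally show ?thesis using None by simp
  next
    case (Some \<tau>)
    have "(\<lambda>\<omega>. trace (\<Omega> \<omega>) P ins) -` {Some \<tau>} \<inter> space M = {\<omega> \<in> space M. trace (\<Omega> \<omega>) P ins = Some \<tau>}"
      by auto
    with S[of \<tau>] Some show ?thesis by simp
  qed
  then show ?thesis by (simp add: measurable_count_space_eq2_countable)
qed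

text \<open>The run factors through the countable type of transcripts by
  \<open>run_of_trace\<close>, so no measurable structure on runs or stores is involved.\<close>

lemma measurable_run_compose:
  assumes "\<And>i r. (\<lambda>\<omega>. \<Omega> \<omega> i r) \<in> measurable M (count_space UNIV)"
    and "\<And>v. (\<lambda>\<omega>. G v \<omega>) \<in> measurable M N"
  shows "(\<lambda>\<omega>. G (run (\<Omega> \<omega>) P ins) \<omega>) \<in> measurable M N"
proof -
  have "(\<lambda>\<omega>. G (run_of_trace P ins (trace (\<Omega> \<omega>) P ins)) \<omega>) \<in> measurable M N"
    by (rule measurable_compose_countable[where f = "\<lambda>k \<omega>. G (run_of_trace P ins k) \<omega>"])
      (rule assms(2), rule measurable_trace[OF assms(1)])
  then show ?thesis by (simp only: run_of_trace)
qed

text \<open>After an oracle gate, the amplitude at one basis vector depends on a single value of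
  \<open>f\<close>, which ranges over a countable type. The state \<open>\<psi>\<close> depends on
  \<open>\<omega>\<close> too, since it stands for the state after the gates already
  applied.\<close>

lemma borel_measurable_apply_gates:
  assumes f [measurable]: "\<And>x. (\<lambda>\<omega>. f \<omega> x) \<in> measurable M (count_space UNIV)"
    and "\<And>b. (\<lambda>\<omega>. \<psi> \<omega> b) \<in> borel_measurable M"
  shows "(\<lambda>\<omega>. fold (apply_gate (f \<omega>)) gs (\<psi> \<omega>) b) \<in> borel_measurable M"
  using assms(2)
proof (induction gs arbitrary: \<psi>)
  case Nil
  then show ?case by simp
next
  case (Cons g gs)
  have "(\<lambda>\<omega>. apply_gate (f \<omega>) g (\<psi> \<omega>) b) \<in> borel_measurable M" for b
  proof (cases g)
    case (QAsk xs ys)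
    have "(\<lambda>\<omega>. \<psi> \<omega> (xor_wires ys (f \<omega> (map ((!) b) xs)) b)) \<in> borel_measurable M"
      by (rule measurable_compose_countable[OF _ f]) (rule Cons.prems)
    then show ?thesis by (simp add: QAsk)
  qed (use Cons.prems in \<open>auto intro!: borel_measurable_divide borel_measurable_add borel_measurable_times borel_measurable_const\<close>)
  then show ?case using Cons.IH by simp
qed

lemma borel_measurable_measure_prob:
  assumes "\<And>x. (\<lambda>\<omega>. f \<omega> x) \<in> measurable M (count_space UNIV)"
  shows "(\<lambda>\<omega>. measure_prob C (f \<omega>) b) \<in> borel_measurable M"
proof -
  have [measurable]: "(\<lambda>\<omega>. fold (apply_gate (f \<omega>)) (gates C)
      (\<lambda>b'. if b' = replicate (wires C) False then 1 else 0) b) \<in> borel_measurable M"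
    by (rule borel_measurable_apply_gates[OF assms]) auto
  show ?thesis unfolding measure_prob_def by measurable
qed

text \<open>Change of variables along the coordinatewise map, for each circuit and each outcome
  separately.\<close>

lemma integral_measure_prob_random_oracle_map:
  fixes g :: "'c \<Rightarrow> bits"
  shows "(\<integral>Oc. measure_prob C (\<lambda>r. g (Oc r)) b \<partial>random_oracle d)
    = (\<integral>H. measure_prob C H b \<partial>random_oracle (map_pmf g d))"
proof -
  have "(\<integral>H. measure_prob C H b \<partial>random_oracle (map_pmf g d))
      = (\<integral>H. measure_prob C H b \<partial>distr (random_oracle d) (random_oracle (map_pmf g d)) (\<lambda>Oc r. g (Oc r)))"
    by (simp only: distr_random_oracle_map)
  also have "\<dots> = (\<integral>Oc. measure_prob C (\<lambda>r. g (Oc r)) b \<partial>random_oracle d)"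
    by (rule integral_distr[OF measurable_map_oracle]) (rule borel_measurable_measure_prob, measurable)
  finally show ?thesis by simp
qed


section \<open>The simulated hash function\<close>

lemma pair_pmf_of_set:
  assumes "finite A" "A \<noteq> {}" "finite B" "B \<noteq> {}"
  shows "pair_pmf (pmf_of_set A) (pmf_of_set B) = pmf_of_set (A \<times> B)"
proof (rule pmf_eqI)
  fix x :: "'a \<times> 'b"
  show "pmf (pair_pmf (pmf_of_set A) (pmf_of_set B)) x = pmf (pmf_of_set (A \<times> B)) x"
    using assms by (cases x) (auto simp: pmf_pair pmf_of_set card_cartesian_product indicator_def)
qed

lemma vdist_eq_0: "(\<And>x. f x = g x) \<Longrightarrow> vdist f g = 0"
  by (simp add: vdist_def)

lemma negligible_0: "negligible (\<lambda>_. 0)"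
  by (simp add: negligible_def)

text \<open>\<open>rd_rand\<close> as a function of the single value \<open>Oc r\<close>: the
  simulated hash function arises from \<open>Oc\<close> by a coordinatewise map.\<close>

definition claw_hash :: "tdp \<Rightarrow> tdp \<Rightarrow> bits \<Rightarrow> bits \<times> nat \<Rightarrow> bits" where
  "claw_hash F1 F2 pk c = (if snd c = 1 then tdp_eval F2 pk (fst c) else tdp_eval F1 pk (fst c))"

lemma claw_reduction_simps [simp]:
  "rd_oc (claw_reduction F1 F2 p) n pk = pair_pmf (pmf_of_set (tdp_dom F1 pk)) (pmf_of_set {1..p n})"
  "rd_enc (claw_reduction F1 F2 p) c = enc_nat (snd c) @ fst c"
  "rd_start (claw_reduction F1 F2 p) pk = (pk, pk)"
  "rd_rand (claw_reduction F1 F2 p) Oc r pk = claw_hash F1 F2 pk (Oc r)"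
  "rd_sign (claw_reduction F1 F2 p) Oc r pk = (if snd (Oc r) \<noteq> 1 then Some (fst (Oc r)) else None)"
  "rd_finish (claw_reduction F1 F2 p) Oc r \<sigma> pk = [\<sigma>, fst (Oc r)]"
  "rd_instance (claw_reduction F1 F2 p) pk = pk"
  by (simp_all add: claw_reduction_def claw_hash_def split: prod.splits)

lemma fdh_simps [simp]:
  "sig_gen (fdh F) = tdp_gen F"
  "sig_range (fdh F) = tdp_dom F"
  "sig_sign (fdh F) H sk m = return_pmf (tdp_inv F sk (H m))"
  "sig_verify (fdh F) H pk m \<sigma> \<longleftrightarrow> \<sigma> \<in> tdp_dom F pk \<and> tdp_eval F pk \<sigma> = H m"
  by (simp_all add: fdh_def)

lemma claw_problem_simps [simp]:
  "pr_inst (claw_problem F1 F2) n = map_pmf snd (tdp_gen F1 n)"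
  "pr_wins (claw_problem F1 F2) pk [x1, x2] \<longleftrightarrow> is_claw F1 F2 pk x1 x2"
  by (simp_all add: claw_problem_def)

lemma trapdoor_permutation_key:
  assumes "trapdoor_permutation F" "(sk, pk) \<in> set_pmf (tdp_gen F n)"
  shows "tdp_dom F pk \<noteq> {}"
    and "x \<in> tdp_dom F pk \<Longrightarrow> y \<in> tdp_dom F pk \<Longrightarrow> length x = length y"
    and "bij_betw (tdp_eval F pk) (tdp_dom F pk) (tdp_dom F pk)"
    and "x \<in> tdp_dom F pk \<Longrightarrow> tdp_inv F sk (tdp_eval F pk x) = x"
proof -
  have "\<forall>n. \<forall>(sk, pk) \<in> set_pmf (tdp_gen F n).
        tdp_dom F pk \<noteq> {} \<and>
        (\<forall>x \<in> tdp_dom F pk. \<forall>y \<in> tdp_dom F pk. length x = length y) \<and>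
        bij_betw (tdp_eval F pk) (tdp_dom F pk) (tdp_dom F pk) \<and>
        (\<forall>x \<in> tdp_dom F pk. tdp_inv F sk (tdp_eval F pk x) = x)"
    using assms(1) unfolding trapdoor_permutation_def by (elim conjE)
  from bspec[OF spec[OF this, of n] assms(2)]
  have *: "tdp_dom F pk \<noteq> {} \<and>
        (\<forall>x \<in> tdp_dom F pk. \<forall>y \<in> tdp_dom F pk. length x = length y) \<and>
        bij_betw (tdp_eval F pk) (tdp_dom F pk) (tdp_dom F pk) \<and>
        (\<forall>x \<in> tdp_dom F pk. tdp_inv F sk (tdp_eval F pk x) = x)"
    unfolding prod.case .
  show "tdp_dom F pk \<noteq> {}"
    and "x \<in> tdp_dom F pk \<Longrightarrow> y \<in> tdp_dom F pk \<Longrightarrow> length x = length y"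
    and "bij_betw (tdp_eval F pk) (tdp_dom F pk) (tdp_dom F pk)"
    and "x \<in> tdp_dom F pk \<Longrightarrow> tdp_inv F sk (tdp_eval F pk x) = x"
    using * by blast+
qed

section \<open>One fixed key pair, with \<open>k\<close> for the value of \<open>p\<close>\<close>

locale claw_pair_key =
  fixes F1 F2 :: tdp and n :: nat and sk pk :: bits and k :: nat
  assumes claw_free: "claw_free_pair F1 F2"
    and key: "(sk, pk) \<in> set_pmf (tdp_gen F1 n)"
    and k_pos: "1 \<le> k"
begin

abbreviation D :: "bits set" where "D \<equiv> tdp_dom F1 pk"
abbreviation hash :: "bits \<times> nat \<Rightarrow> bits" where "hash \<equiv> claw_hash F1 F2 pk"
abbreviation oc :: "(bits \<times> nat) pmf" where "oc \<equiv> pair_pmf (pmf_of_set D) (pmf_of_set {1..k})"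

lemma tdp1: "trapdoor_permutation F1" and tdp2: "trapdoor_permutation F2"
  using claw_free by (auto simp: claw_free_pair_def)

lemma key2: "(sk, pk) \<in> set_pmf (tdp_gen F2 n)"
  using claw_free key by (simp add: claw_free_pair_def)

lemma dom2: "tdp_dom F2 pk = D"
proof -
  have "\<forall>n. \<forall>(sk, pk) \<in> set_pmf (tdp_gen F1 n). tdp_dom F1 pk = tdp_dom F2 pk"
    using claw_free unfolding claw_free_pair_def by (elim conjE)
  from bspec[OF spec[OF this, of n] key] show ?thesis by simp
qed

lemmas dom_nonempty = trapdoor_permutation_key(1)[OF tdp1 key]
  and dom_length = trapdoor_permutation_key(2)[OF tdp1 key]
  and bij1 = trapdoor_permutation_key(3)[OF tdp1 key]
  and inv_eval = trapdoor_permutation_key(4)[OF tdp1 key]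
  and bij2 = trapdoor_permutation_key(3)[OF tdp2 key2, unfolded dom2]

text \<open>Strings of one common length are finite in number; this makes the uniform distribution
  on the domain meaningful.\<close>

lemma finite_dom: "finite D"
proof -
  obtain x where x: "x \<in> D" using dom_nonempty by blast
  have "D \<subseteq> {xs. set xs \<subseteq> UNIV \<and> length xs = length x}" using dom_length[OF _ x] by auto
  then show ?thesis by (rule finite_subset) (intro finite_lists_length_eq, simp)
qed

lemma set_pmf_oc: "set_pmf oc = D \<times> {1..k}"
  using finite_dom dom_nonempty k_pos by simp

lemma hash_in_dom: "c \<in> D \<times> {1..k} \<Longrightarrow> hash c \<in> D"
  using bij_betwE[OF bij1] bij_betwE[OF bij2] by (auto simp: claw_hash_def)

text \<open>The hash value is uniform whatever the second component is, hence independent of it.\<close>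

lemma map_pmf_hash_snd: "map_pmf (\<lambda>c. (hash c, snd c)) oc = oc"
proof -
  \<comment> \<open>The mark is kept, so for each \<open>b\<close> only one of the two permutations
    is at work.\<close>
  have inj: "inj_on (\<lambda>c. (hash c, snd c)) (D \<times> {1..k})"
    using bij_betw_imp_inj_on[OF bij1] bij_betw_imp_inj_on[OF bij2]
    by (auto simp: inj_on_def claw_hash_def split: if_splits)
  have "(\<lambda>c. (hash c, snd c)) ` (D \<times> {1..k}) \<subseteq> D \<times> {1..k}"
    using hash_in_dom by auto
  then have "bij_betw (\<lambda>c. (hash c, snd c)) (D \<times> {1..k}) (D \<times> {1..k})"
    using inj finite_dom by (intro bij_betw_imageI endo_inj_surj) auto
  then show ?thesis
    using finite_dom dom_nonempty k_pos by (simp add: pair_pmf_of_set map_pmf_of_set_bij_betw)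
qed

lemma map_pmf_hash: "map_pmf hash oc = pmf_of_set D"
proof -
  have "map_pmf hash oc = map_pmf fst (map_pmf (\<lambda>c. (hash c, snd c)) oc)"
    by (simp add: pmf.map_comp o_def)
  also have "\<dots> = pmf_of_set D" unfolding map_pmf_hash_snd by (rule map_fst_pair_pmf)
  finally show ?thesis .
qed

text \<open>By \<open>map_pmf_hash_snd\<close> the pair of hash value and mark is distributed like
  the product \<open>oc\<close>, so the two are independent.\<close>

lemma prob_hash_snd:
  "measure_pmf.prob oc (hash -` V \<inter> snd -` W)
    = measure_pmf.prob oc (hash -` V) * measure_pmf.prob (pmf_of_set {1..k}) W"
proof -
  have "measure_pmf.prob oc (hash -` V \<inter> snd -` W)
      = measure_pmf.prob (map_pmf (\<lambda>c. (hash c, snd c)) oc) (V \<times> W)"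
    by (simp only: measure_map_pmf) (rule arg_cong[where f = "measure_pmf.prob oc"], auto)
  also have "\<dots> = measure_pmf.prob (pmf_of_set D) V * measure_pmf.prob (pmf_of_set {1..k}) W"
    unfolding map_pmf_hash_snd by (rule measure_pmf_prob_product) auto
  also have "measure_pmf.prob (pmf_of_set D) V = measure_pmf.prob oc (hash -` V)"
    using measure_map_pmf[of hash oc V] by (simp only: map_pmf_hash)
  finally show ?thesis .
qed

lemma prob_eq_1: "measure_pmf.prob (pmf_of_set {1..k}) {1} = 1 / real k"
proof -
  have "{1..k} \<inter> {1} = {1}" using k_pos by auto
  then show ?thesis using k_pos by (simp add: measure_pmf_of_set)
qed

lemma prob_neq_1: "measure_pmf.prob (pmf_of_set {1..k}) (- {1}) = 1 - 1 / real k"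
  using measure_pmf.prob_compl[of "{1}" "pmf_of_set {1..k}"] prob_eq_1 by (simp add: Compl_eq_Diff_UNIV)

lemma AE_oc: "AE Oc in random_oracle oc. \<forall>r. Oc r \<in> D \<times> {1..k}"
  using AE_random_oracle_support[of oc] by (simp only: set_pmf_oc)

lemma signature_correct:
  assumes "c \<in> D \<times> {1..k}" "snd c \<noteq> 1"
  shows "tdp_inv F1 sk (hash c) = fst c"
  using assms inv_eval by (auto simp: claw_hash_def)

text \<open>Without an abort the hash of \<open>m\<close> is the \<open>F1\<close>-image of the
  first component, whose inverse image is exactly the signature returned, so the integrand is almost
  surely an indicator. The denominator \<open>N\<close> is arbitrary, which includes the value
  0.\<close>

lemma sign_distance_0:
  assumes M: "M = random_oracle oc"
  shows "vdist
      (\<lambda>(ys, \<sigma>). measure M {Oc. map (\<lambda>r. hash (Oc r)) rs = ys \<and>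
          (if snd (Oc m) \<noteq> 1 then Some (fst (Oc m)) else None) = Some \<sigma>} / N)
      (\<lambda>(ys, \<sigma>). (\<integral>Oc. (if map (\<lambda>r. hash (Oc r)) rs = ys \<and>
            (if snd (Oc m) \<noteq> 1 then Some (fst (Oc m)) else None) \<noteq> None
          then pmf (return_pmf (tdp_inv F1 sk (hash (Oc m)))) \<sigma> else 0) \<partial>M) / N) = 0"
proof (rule vdist_eq_0, clarify)
  fix ys \<sigma>
  have [measurable]: "Measurable.pred M (\<lambda>Oc. map (\<lambda>r. hash (Oc r)) rs = ys)"
  proof -
    have "(\<lambda>Oc. map (\<lambda>r. hash (Oc r)) rs) \<in> measurable M (count_space UNIV)"
    proof (induction rs)
      case (Cons r rs)
      have "(\<lambda>Oc. hash (Oc r) # ys) \<in> measurable M (count_space UNIV)" for ys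
        unfolding M by (rule measurable_query_compose)
      from measurable_compose_countable[OF this Cons] show ?case by simp
    qed simp
    then show ?thesis by measurable
  qed
  let ?S = "{Oc. map (\<lambda>r. hash (Oc r)) rs = ys \<and>
          (if snd (Oc m) \<noteq> 1 then Some (fst (Oc m)) else None) = Some \<sigma>}"
  let ?f = "\<lambda>Oc. if map (\<lambda>r. hash (Oc r)) rs = ys \<and>
            (if snd (Oc m) \<noteq> 1 then Some (fst (Oc m)) else None) \<noteq> None
          then pmf (return_pmf (tdp_inv F1 sk (hash (Oc m)))) \<sigma> else 0"
  have [measurable]: "Measurable.pred M
      (\<lambda>Oc. (if snd (Oc m) \<noteq> 1 then Some (fst (Oc m)) else None) = Some \<sigma>)"
    unfolding M by (rule measurable_query_compose)
  have S: "?S \<in> sets M"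
  proof -
    have "Measurable.pred M (\<lambda>Oc. map (\<lambda>r. hash (Oc r)) rs = ys \<and>
          (if snd (Oc m) \<noteq> 1 then Some (fst (Oc m)) else None) = Some \<sigma>)"
      by (rule pred_intros_logic) fact+
    then show ?thesis by (simp add: pred_def M)
  qed
  have f: "?f \<in> borel_measurable M"
  proof -
    \<comment> \<open>Isolates the part of the integrand that depends on the coordinate
      \<open>m\<close> alone.\<close>
    define g where "g c = (if (if snd c \<noteq> 1 then Some (fst c) else None) \<noteq> None
      then pmf (return_pmf (tdp_inv F1 sk (hash c))) \<sigma> else 0)" for c :: "bits \<times> nat"
    have [measurable]: "(\<lambda>Oc. g (Oc m)) \<in> borel_measurable M"
      unfolding M by (rule measurable_compose[OF measurable_query]) simp
    have "(\<lambda>Oc. if map (\<lambda>r. hash (Oc r)) rs = ys then g (Oc m) else 0) \<in> borel_measurable M"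
      by measurable
    moreover have "(\<lambda>Oc. if map (\<lambda>r. hash (Oc r)) rs = ys then g (Oc m) else 0) = ?f"
      by (auto simp: g_def)
    ultimately show ?thesis by (simp only:)
  qed
  have "(\<integral>Oc. (if map (\<lambda>r. hash (Oc r)) rs = ys \<and>
            (if snd (Oc m) \<noteq> 1 then Some (fst (Oc m)) else None) \<noteq> None
          then pmf (return_pmf (tdp_inv F1 sk (hash (Oc m)))) \<sigma> else 0) \<partial>M)
      = (\<integral>Oc. indicator ?S Oc \<partial>M)"
  proof (rule integral_cong_AE)
    show "AE Oc in M. (if map (\<lambda>r. hash (Oc r)) rs = ys \<and>
            (if snd (Oc m) \<noteq> 1 then Some (fst (Oc m)) else None) \<noteq> None
          then pmf (return_pmf (tdp_inv F1 sk (hash (Oc m)))) \<sigma> else 0) = indicator ?S Oc"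
      using AE_oc unfolding M
    proof eventually_elim
      case (elim Oc)
      then have "snd (Oc m) \<noteq> 1 \<Longrightarrow> tdp_inv F1 sk (hash (Oc m)) = fst (Oc m)"
        using signature_correct by blast
      then show ?case by (auto simp: indicator_def)
    qed
    show "indicator ?S \<in> borel_measurable M" using S by (rule borel_measurable_indicator)
  qed (rule f)
  also have "\<dots> = measure M ?S" using S by (simp add: M)
  finally show "measure M ?S / N = (\<integral>Oc. (if map (\<lambda>r. hash (Oc r)) rs = ys \<and>
            (if snd (Oc m) \<noteq> 1 then Some (fst (Oc m)) else None) \<noteq> None
          then pmf (return_pmf (tdp_inv F1 sk (hash (Oc m)))) \<sigma> else 0) \<partial>M) / N" by simp
qed

end

section \<open>Conditions on INSTANCE, RAND and SIGN\<close>

lemma pr_inst_key: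
  assumes "x \<in> set_pmf (pr_inst (claw_problem F1 F2) n)"
  obtains sk where "(sk, x) \<in> set_pmf (tdp_gen F1 n)"
  using assms by auto

lemma hf_instance_claw:
  "hf_instance (fdh F1) (claw_problem F1 F2) (claw_reduction F1 F2 p)"
  unfolding hf_instance_def
proof (intro conjI)
  have "solves_in_poly_time (Copy 0 1) {(no_oracles, ins, outs) | ins outs.
      (ins, outs) \<in> {([unary n, pk], [rd_instance (claw_reduction F1 F2 p) pk]) | n sk pk.
        (sk, pk) \<in> set_pmf (sig_gen (fdh F1) n)}}"
    unfolding solves_in_poly_time_def
  proof (rule exI[of _ "[:1, 1:]"], clarify)
    fix n sk pk L
    have e: "exec no_oracles (Copy 0 1) (init_store [unary n, pk]) (1 + length pk) []
        ((init_store [unary n, pk])(0 := pk))"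
      using exec.Copy[of no_oracles 0 1 "init_store [unary n, pk]"] by (simp add: init_store_simps)
    show "\<exists>t \<tau> s. exec no_oracles (Copy 0 1) (init_store [unary n, pk]) t \<tau> s \<and>
        map s [0..<length [rd_instance (claw_reduction F1 F2 p) pk]] = [rd_instance (claw_reduction F1 F2 p) pk] \<and>
        t \<le> poly [:1, 1:] ((\<Sum>x\<leftarrow>[unary n, pk]. length x) + L)"
      by (rule exI, rule exI, rule exI, rule conjI, rule e) simp
  qed
  then show "poly_time_computable {([unary n, pk], [rd_instance (claw_reduction F1 F2 p) pk]) | n sk pk.
      (sk, pk) \<in> set_pmf (sig_gen (fdh F1) n)}"
    unfolding poly_time_computable_def by (intro exI[of _ "Copy 0 1"]) simp
  show "negligible (\<lambda>n. vdist
      (pmf (map_pmf (\<lambda>(sk, pk). rd_instance (claw_reduction F1 F2 p) pk) (sig_gen (fdh F1) n)))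
      (pmf (pr_inst (claw_problem F1 F2) n)))"
  proof -
    have "(\<lambda>(sk, pk). pk) = (snd :: bits \<times> bits \<Rightarrow> bits)" by auto
    then show ?thesis by (simp add: vdist_def negligible_0)
  qed
qed auto

text \<open>The simulated hash function has exactly the law of a random oracle, so the output
  distributions of every circuit coincide and the bound 0 serves for all keys.\<close>

lemma hf_rand_claw:
  assumes "claw_free_pair F1 F2" "\<And>n. 1 \<le> p n"
  shows "hf_rand (fdh F1) (claw_problem F1 F2) (claw_reduction F1 F2 p)"
  unfolding hf_rand_def
proof (intro allI impI exI[of _ "\<lambda>_. 0"] conjI ballI negligible_0)
  fix Q :: "bits list \<Rightarrow> circuit" and n x pk z
  assume x: "x \<in> set_pmf (pr_inst (claw_problem F1 F2) n)"
    and start: "rd_start (claw_reduction F1 F2 p) x = (pk, z)"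
  obtain sk where "(sk, x) \<in> set_pmf (tdp_gen F1 n)" using x by (rule pr_inst_key)
  then interpret claw_pair_key F1 F2 n sk x "p n" using assms by unfold_locales
  have "pk = x" "z = x" using start by auto
  then show "vdist
      (\<lambda>b. \<integral>Oc. measure_prob (Q [unary n, pk, z]) (\<lambda>r. rd_rand (claw_reduction F1 F2 p) Oc r z) b
        \<partial>random_oracle (rd_oc (claw_reduction F1 F2 p) n x))
      (\<lambda>b. \<integral>H. measure_prob (Q [unary n, pk, z]) H b
        \<partial>random_oracle (pmf_of_set (sig_range (fdh F1) pk))) \<le> 0"
    by (simp only: claw_reduction_simps fdh_simps integral_measure_prob_random_oracle_map map_pmf_hash
        vdist_eq_0 order_refl)
qed

lemma hf_sign_claw:
  assumes "claw_free_pair F1 F2" "\<And>n. 1 \<le> p n"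
  shows "hf_sign (fdh F1) (claw_problem F1 F2) (claw_reduction F1 F2 p)"
  unfolding hf_sign_def
proof (intro conjI allI ballI impI exI[of _ "\<lambda>_. 0"] negligible_0)
  fix n x pk z m \<sigma> Oc
  assume x: "x \<in> set_pmf (pr_inst (claw_problem F1 F2) n)"
    and Oc: "Oc \<in> oc_values (claw_reduction F1 F2 p) n x"
    and start: "rd_start (claw_reduction F1 F2 p) x = (pk, z)"
    and sign: "rd_sign (claw_reduction F1 F2 p) Oc m z = Some \<sigma>"
  obtain sk where "(sk, x) \<in> set_pmf (tdp_gen F1 n)" using x by (rule pr_inst_key)
  then interpret claw_pair_key F1 F2 n sk x "p n" using assms by unfold_locales
  have "Oc m \<in> set_pmf oc" using Oc by (simp add: oc_values_def)
  then have "Oc m \<in> D \<times> {1..p n}" by (simp only: set_pmf_oc)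
  with start sign show "sig_verify (fdh F1) (\<lambda>r. rd_rand (claw_reduction F1 F2 p) Oc r z) pk m \<sigma>"
    by (auto simp: claw_hash_def split: if_splits)
next
  fix n x y
  assume x: "x \<in> set_pmf (pr_inst (claw_problem F1 F2) n)" and y: "y \<in> set_pmf (sig_gen (fdh F1) n)"
  obtain sk pk where skpk: "y = (sk, pk)" by (cases y)
  then interpret claw_pair_key F1 F2 n sk pk "p n" using assms y by unfold_locales simp_all
  show "case y of (sk, pk) \<Rightarrow> \<forall>z m rs. rd_start (claw_reduction F1 F2 p) x = (pk, z) \<longrightarrow>
      (let M = random_oracle (rd_oc (claw_reduction F1 F2 p) n x);
           N = measure M {Oc. rd_sign (claw_reduction F1 F2 p) Oc m z \<noteq> None}
       in vdist
         (\<lambda>(ys, \<sigma>). measure M {Oc. map (\<lambda>r. rd_rand (claw_reduction F1 F2 p) Oc r z) rs = ys \<and>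
            rd_sign (claw_reduction F1 F2 p) Oc m z = Some \<sigma>} / N)
         (\<lambda>(ys, \<sigma>). (\<integral>Oc. (if map (\<lambda>r. rd_rand (claw_reduction F1 F2 p) Oc r z) rs = ys \<and>
              rd_sign (claw_reduction F1 F2 p) Oc m z \<noteq> None
            then pmf (sig_sign (fdh F1) (\<lambda>r. rd_rand (claw_reduction F1 F2 p) Oc r z) sk m) \<sigma> else 0) \<partial>M) / N)
       \<le> 0)"
    unfolding skpk prod.case
  proof (intro allI impI)
    fix z m rs
    assume "rd_start (claw_reduction F1 F2 p) x = (pk, z)"
    then have "x = pk" "z = pk" by auto
    then show "let M = random_oracle (rd_oc (claw_reduction F1 F2 p) n x);
           N = measure M {Oc. rd_sign (claw_reduction F1 F2 p) Oc m z \<noteq> None}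
       in vdist
         (\<lambda>(ys, \<sigma>). measure M {Oc. map (\<lambda>r. rd_rand (claw_reduction F1 F2 p) Oc r z) rs = ys \<and>
            rd_sign (claw_reduction F1 F2 p) Oc m z = Some \<sigma>} / N)
         (\<lambda>(ys, \<sigma>). (\<integral>Oc. (if map (\<lambda>r. rd_rand (claw_reduction F1 F2 p) Oc r z) rs = ys \<and>
              rd_sign (claw_reduction F1 F2 p) Oc m z \<noteq> None
            then pmf (sig_sign (fdh F1) (\<lambda>r. rd_rand (claw_reduction F1 F2 p) Oc r z) sk m) \<sigma> else 0) \<partial>M) / N)
       \<le> 0"
      unfolding Let_def claw_reduction_simps fdh_simps by (simp only: sign_distance_0[OF refl] order_refl)
  qed
qed


section \<open>The forger inside the reduction\<close>

text \<open>Both oracles of the forger answer a query \<open>r\<close> from the single value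
  \<open>Oc r\<close>. In this form the conditions imposed by a transcript are conditions on single
  coordinates.\<close>

definition answer :: "('c \<Rightarrow> bits) \<Rightarrow> ('c \<Rightarrow> bits) \<Rightarrow> nat \<Rightarrow> 'c \<Rightarrow> bits" where
  "answer u v i c = (if i = 0 then u c else if i = 1 then v c else [])"

lemma forger_oracles_answer:
  "forger_oracles (\<lambda>r. u (Oc r)) (\<lambda>r. v (Oc r)) = (\<lambda>i r. answer u v i (Oc r))"
  by (simp add: forger_oracles_def answer_def fun_eq_iff)

lemma set_signed: "m \<in> set (signed \<tau>) \<longleftrightarrow> (\<exists>y. (1, m, y) \<in> set \<tau>)"
  by (force simp: signed_def)

text \<open>A point may be queried several times and at both oracles. Collecting the conditions on
  it gives one set for each distinct point, and so a cylinder.\<close>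

lemma trace_answer_iff:
  assumes "trace (\<lambda>i r. ans i (Oc' r)) P ins = Some \<tau>"
  shows "trace (\<lambda>i r. ans i (Oc r)) P ins = Some \<tau> \<longleftrightarrow>
    (\<forall>r \<in> (fst \<circ> snd) ` set \<tau>. Oc r \<in> {c. \<forall>i y. (i, r, y) \<in> set \<tau> \<longrightarrow> ans i c = y})"
  unfolding trace_agree_iff[OF assms] by force

lemma pred_query: "Measurable.pred (random_oracle d) (\<lambda>Oc. Q (Oc r))"
  by (rule measurable_query_compose)

lemma measurable_trace_answer:
  "(\<lambda>Oc. trace (\<lambda>i r. ans i (Oc r)) P ins) \<in> measurable (random_oracle d) (count_space UNIV)"
  by (rule measurable_trace) (rule measurable_query_compose)

lemma forger_halts:
  assumes "ppt_adversary A"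
  obtains T :: "nat poly" where
    "\<And>H Sg w x y L. (\<And>r. length (H r) \<le> L) \<Longrightarrow> (\<And>r. length (Sg r) \<le> L) \<Longrightarrow>
      \<exists>t \<tau> s. exec (forger_oracles H Sg) (adv_prog A) (init_store [w, x, y]) t \<tau> s \<and>
        t \<le> poly T (length w + length x + length y + L)"
proof (rule solves_in_poly_time_exec[OF assms[unfolded ppt_adversary_def]])
  fix T :: "nat poly"
  assume T: "\<And>\<Omega> ins outs L. (\<Omega>, ins, outs) \<in> {(\<Omega>, ins, []) | \<Omega> ins. length ins = 3} \<Longrightarrow>
       (\<And>i r. length (\<Omega> i r) \<le> L) \<Longrightarrow>
       \<exists>t \<tau> s. exec \<Omega> (adv_prog A) (init_store ins) t \<tau> s \<and> map s [0..<length outs] = outs \<and>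
         t \<le> poly T ((\<Sum>x\<leftarrow>ins. length x) + L)"
  show thesis
  proof (rule that)
    fix H Sg :: "bits \<Rightarrow> bits" and w x y :: bits and L
    assume "\<And>r. length (H r) \<le> L" "\<And>r. length (Sg r) \<le> L"
    then have "length (forger_oracles H Sg i r) \<le> L" for i r
      by (simp add: forger_oracles_def)
    from T[of "forger_oracles H Sg" "[w, x, y]" "[]", OF _ this]
    obtain t \<tau> s where "exec (forger_oracles H Sg) (adv_prog A) (init_store [w, x, y]) t \<tau> s"
        "t \<le> poly T ((\<Sum>x\<leftarrow>[w, x, y]. length x) + L)"
      by auto
    then show "\<exists>t \<tau> s. exec (forger_oracles H Sg) (adv_prog A) (init_store [w, x, y]) t \<tau> s \<and>
        t \<le> poly T (length w + length x + length y + L)"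
      by (intro exI conjI) (assumption, simp add: add.assoc)
  qed
qed

text \<open>The empty string for a marked message is the convention of \<open>sim_run\<close> for an
  abort.\<close>

definition sim_sig :: "bits \<times> nat \<Rightarrow> bits" where
  "sim_sig c = (if snd c \<noteq> 1 then fst c else [])"

section \<open>The attack for a fixed key and fixed coins\<close>

locale claw_attack = claw_pair_key +
  fixes A :: adversary and \<rho> :: bits
  assumes ppt: "ppt_adversary A"
begin

abbreviation sim_oracles :: "(bits \<Rightarrow> bits \<times> nat) \<Rightarrow> oracles" where
  "sim_oracles Oc \<equiv> (\<lambda>i r. answer hash sim_sig i (Oc r))"

text \<open>The genuine attack against the same hash function: signatures are computed with the
  secret key from hash values, so the marks do not enter.\<close>

abbreviation real_oracles :: "(bits \<Rightarrow> bits \<times> nat) \<Rightarrow> oracles" where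
  "real_oracles Oc \<equiv> (\<lambda>i r. answer hash (\<lambda>c. tdp_inv F1 sk (hash c)) i (Oc r))"

abbreviation attack_inputs :: "bits list" where
  "attack_inputs \<equiv> [unary n, pk, \<rho>]"

abbreviation sim_trace :: "(bits \<Rightarrow> bits \<times> nat) \<Rightarrow> transcript option" where
  "sim_trace Oc \<equiv> trace (sim_oracles Oc) (adv_prog A) attack_inputs"

abbreviation real_trace :: "(bits \<Rightarrow> bits \<times> nat) \<Rightarrow> transcript option" where
  "real_trace Oc \<equiv> trace (real_oracles Oc) (adv_prog A) attack_inputs"

abbreviation unmarked :: "transcript \<Rightarrow> (bits \<Rightarrow> bits \<times> nat) \<Rightarrow> bool" where
  "unmarked \<tau> Oc \<equiv> \<forall>m \<in> set (signed \<tau>). snd (Oc m) \<noteq> 1"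

lemma pred_unmarked: "Measurable.pred (random_oracle d) (unmarked \<tau>)"
  by (rule pred_intros_finite) (simp, rule pred_query)

text \<open>Equality holds by independence; the inequality is the form that
  \<open>measure_cylinder_restrict_ge\<close> asks for.\<close>

lemma prob_marked_given_hash:
  "1 / real k * measure_pmf.prob oc (hash -` V) \<le> measure_pmf.prob oc (hash -` V \<inter> {c. snd c = 1})"
proof -
  have "{c :: bits \<times> nat. snd c = 1} = snd -` {1}" by auto
  then show ?thesis by (simp only: prob_hash_snd prob_eq_1) simp
qed

lemma prob_unmarked_given_hash:
  "(1 - 1 / real k) * measure_pmf.prob oc (hash -` V) \<le> measure_pmf.prob oc (hash -` V \<inter> {c. snd c \<noteq> 1})"
proof -
  have "{c :: bits \<times> nat. snd c \<noteq> 1} = snd -` (- {1})" by auto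
  then show ?thesis by (simp only: prob_hash_snd prob_neq_1) simp
qed

text \<open>\<open>ppt_adversary\<close> guarantees halting for oracles whose answers have bounded
  length. Here all answers are empty or elements of \<open>D\<close>, which share one
  length.\<close>

lemma trace_not_None:
  assumes "\<And>r. Oc r \<in> D \<times> {1..k}"
  shows "sim_trace Oc \<noteq> None" "real_trace Oc \<noteq> None"
proof -
  obtain x where x: "x \<in> D" using dom_nonempty by blast
  have len: "length y \<le> length x" if "y \<in> D" for y
    using dom_length[OF that x] by simp
  have h: "length (hash (Oc r)) \<le> length x" for r
    using assms by (intro len hash_in_dom)
  have i: "length (tdp_inv F1 sk (hash (Oc r))) \<le> length x" for r
  proof -
    obtain y where "y \<in> D" "tdp_eval F1 pk y = hash (Oc r)"
      using hash_in_dom[OF assms[of r]] bij1 by (metis bij_betw_def imageE)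
    then show ?thesis using inv_eval len by metis
  qed
  have s: "length (sim_sig (Oc r)) \<le> length x" for r
    using len assms[of r] by (auto simp: sim_sig_def mem_Times_iff)
  obtain T :: "nat poly" where T: "\<And>H Sg w x y L. (\<And>r. length (H r) \<le> L) \<Longrightarrow> (\<And>r. length (Sg r) \<le> L) \<Longrightarrow>
      \<exists>t \<tau> s. exec (forger_oracles H Sg) (adv_prog A) (init_store [w, x, y]) t \<tau> s \<and>
        t \<le> poly T (length w + length x + length y + L)"
    using forger_halts[OF ppt] by blast
  have "\<exists>\<tau>. sim_trace Oc = Some \<tau>"
    unfolding forger_oracles_answer[symmetric] trace_eq_Some_iff 
    using T[of "\<lambda>r. hash (Oc r)" "length x" "\<lambda>r. sim_sig (Oc r)" "unary n" pk \<rho>, OF h s] by blast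
  then show "sim_trace Oc \<noteq> None" by (metis option.distinct(1))
  have "\<exists>\<tau>. real_trace Oc = Some \<tau>"
    unfolding forger_oracles_answer[symmetric] trace_eq_Some_iff 
    using T[of "\<lambda>r. hash (Oc r)" "length x" "\<lambda>r. tdp_inv F1 sk (hash (Oc r))" "unary n" pk \<rho>, OF h i]
    by blast
  then show "real_trace Oc \<noteq> None" by (metis option.distinct(1))
qed

text \<open>As long as no signed message is marked, the simulated signatures are the correct ones.\<close>

lemma sim_trace_eq_real_trace:
  assumes Oc: "\<And>r. Oc r \<in> D \<times> {1..k}" and \<tau>: "real_trace Oc = Some \<tau>" "unmarked \<tau> Oc"
  shows "sim_trace Oc = Some \<tau>"
proof -
  have "answer hash sim_sig i (Oc r) = y" if q: "(i, r, y) \<in> set \<tau>" for i r y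
  proof -
    have real: "answer hash (\<lambda>c. tdp_inv F1 sk (hash c)) i (Oc r) = y"
      using \<tau>(1) q trace_agree_iff[OF \<tau>(1), of "real_oracles Oc"] by auto
    show ?thesis
    proof (cases "i = 1")
      case True
      then have "snd (Oc r) \<noteq> 1" using \<tau>(2) q set_signed by blast
      then show ?thesis
        using real True signature_correct[OF Oc] by (simp add: answer_def sim_sig_def)
    next
      case False
      then show ?thesis by (simp add: real[symmetric] answer_def)
    qed
  qed
  then show ?thesis unfolding trace_agree_iff[OF \<tau>(1)] by blast
qed

text \<open>Given the genuine transcript, only hash values are constrained, so each of the at most
  \<open>q\<close> distinct signed messages is unmarked with probability \<open>1 - 1/k\<close>,
  independently. If all are unmarked, the simulation has the same transcript and does not
  abort.\<close>

lemma prob_unmarked_ge: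
  assumes q: "\<And>Oc \<tau>. (\<And>r. Oc r \<in> D \<times> {1..k}) \<Longrightarrow> real_trace Oc = Some \<tau> \<Longrightarrow> length (signed \<tau>) \<le> q"
  shows "(1 - 1 / real k) ^ q
    \<le> measure (random_oracle oc) {Oc. unmarked (fst (snd (run (sim_oracles Oc) (adv_prog A) attack_inputs))) Oc}"
proof -
  interpret prob_space "random_oracle oc" by (rule prob_space_random_oracle)
  \<comment> \<open>Runs that do not halt or that make more than \<open>q\<close> signing queries
    have probability 0. Counting them as good makes the comparison trivial for these cases.\<close>
  define G where "G \<kappa> Oc \<longleftrightarrow> (case \<kappa> of None \<Rightarrow> True
    | Some \<tau> \<Rightarrow> length (signed \<tau>) \<le> q \<longrightarrow> unmarked \<tau> Oc)" for \<kappa> Oc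
  have G: "Measurable.pred (random_oracle oc) (G \<kappa>)" for \<kappa>
    unfolding G_def by (cases \<kappa>) (simp_all add: pred_unmarked)
  have c: "0 \<le> 1 - 1 / real k" "1 - 1 / real k \<le> 1" using k_pos by auto
  then have c_le: "(1 - 1 / real k) ^ q * x \<le> x" if "0 \<le> x" for x
    using that by (intro mult_left_le_one_le power_le_one) auto
  have "(1 - 1 / real k) ^ q * prob {Oc \<in> space (random_oracle oc). True}
      \<le> prob {Oc \<in> space (random_oracle oc). G (real_trace Oc) Oc}"
  proof (rule measure_countable_cases_ge[where B = "\<lambda>_ _. True", OF measurable_trace_answer G])
    fix \<kappa>
    have "(1 - 1 / real k) ^ q * prob {Oc. real_trace Oc = \<kappa>}
        \<le> prob {Oc. real_trace Oc = \<kappa> \<and> G \<kappa> Oc}"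
    proof (cases "\<exists>\<tau> Oc'. \<kappa> = Some \<tau> \<and> length (signed \<tau>) \<le> q \<and> real_trace Oc' = Some \<tau>")
      case True
      then obtain \<tau> Oc' where \<kappa>: "\<kappa> = Some \<tau>" and len: "length (signed \<tau>) \<le> q"
        and Oc': "real_trace Oc' = Some \<tau>" by blast
      define J where "J = (fst \<circ> snd) ` set \<tau>"
      \<comment> \<open>The conditions of the transcript, stated for the hash value instead of the
        oracle value: here it matters that \<open>real_oracles\<close> reads only hash
        values.\<close>
      define V where "V r = {h. \<forall>i y. (i, r, y) \<in> set \<tau> \<longrightarrow>
        answer (\<lambda>h. h) (tdp_inv F1 sk) i h = y}" for r
      have trace: "real_trace Oc = Some \<tau> \<longleftrightarrow> (\<forall>r \<in> J. Oc r \<in> hash -` V r)" for Oc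
        unfolding trace_answer_iff[where ans = "answer hash (\<lambda>c. tdp_inv F1 sk (hash c))", OF Oc'] J_def V_def
        by (simp add: answer_def)
      have J: "finite J" "set (signed \<tau>) \<subseteq> J"
        by (force simp: J_def set_signed)+
      \<comment> \<open>Messages signed repeatedly count once, and a base between 0 and 1 makes the
        smaller exponent give the larger power.\<close>
      have "(1 - 1 / real k) ^ q \<le> (1 - 1 / real k) ^ card (set (signed \<tau>))"
        using c len card_length[of "signed \<tau>"] by (intro power_decreasing) auto
      then have "(1 - 1 / real k) ^ q * prob {Oc. real_trace Oc = \<kappa>}
          \<le> (1 - 1 / real k) ^ card (set (signed \<tau>)) * prob {Oc. \<forall>r \<in> J. Oc r \<in> hash -` V r}"
        unfolding \<kappa> trace by (rule mult_right_mono) simp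
      also have "\<dots> \<le> prob {Oc. \<forall>r \<in> J. Oc r \<in> hash -` V r \<and>
          (r \<in> set (signed \<tau>) \<longrightarrow> Oc r \<in> {c. snd c \<noteq> 1})}"
        by (rule measure_cylinder_restrict_ge[OF J c(1) prob_unmarked_given_hash])
      also have "{Oc. \<forall>r \<in> J. Oc r \<in> hash -` V r \<and> (r \<in> set (signed \<tau>) \<longrightarrow> Oc r \<in> {c. snd c \<noteq> 1})}
          = {Oc. real_trace Oc = \<kappa> \<and> G \<kappa> Oc}"
        unfolding \<kappa> trace G_def using J(2) len by auto
      finally show ?thesis .
    next
      case False
      have "{Oc. real_trace Oc = \<kappa>} = {Oc. real_trace Oc = \<kappa> \<and> G \<kappa> Oc}"
        using False by (auto simp: G_def split: option.split)
      then show ?thesis using c_le[of "prob {Oc. real_trace Oc = \<kappa>}"] by simp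
    qed
    then show "(1 - 1 / real k) ^ q * prob {Oc \<in> space (random_oracle oc). real_trace Oc = \<kappa> \<and> True}
        \<le> prob {Oc \<in> space (random_oracle oc). real_trace Oc = \<kappa> \<and> G \<kappa> Oc}"
      by simp
  qed (use c in auto)
  also have "prob {Oc \<in> space (random_oracle oc). True} = 1" using prob_space by simp
  also have "prob {Oc \<in> space (random_oracle oc). G (real_trace Oc) Oc}
      \<le> prob {Oc. unmarked (fst (snd (run (sim_oracles Oc) (adv_prog A) attack_inputs))) Oc}"
  proof (rule finite_measure_mono_AE)
    show "AE Oc in random_oracle oc. Oc \<in> {Oc \<in> space (random_oracle oc). G (real_trace Oc) Oc} \<longrightarrow>
        Oc \<in> {Oc. unmarked (fst (snd (run (sim_oracles Oc) (adv_prog A) attack_inputs))) Oc}"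
      using AE_oc
    proof eventually_elim
      case (elim Oc)
      then have "real_trace Oc \<noteq> None" using trace_not_None(2) by blast
      then obtain \<tau> where \<tau>: "real_trace Oc = Some \<tau>" by blast
      then have "length (signed \<tau>) \<le> q" using elim q by blast
      then have "G (real_trace Oc) Oc \<longleftrightarrow> unmarked \<tau> Oc" by (simp add: \<tau> G_def)
      then show ?case
        using sim_trace_eq_real_trace[OF _ \<tau>] elim trace_run by fastforce
    qed
    have "Measurable.pred (random_oracle oc)
        (\<lambda>Oc. unmarked (fst (snd (run (sim_oracles Oc) (adv_prog A) attack_inputs))) Oc)"
      by (rule measurable_run_compose[where G = "\<lambda>v. unmarked (fst (snd v))"])
        (rule measurable_query_compose, rule pred_unmarked)
    then show "{Oc. unmarked (fst (snd (run (sim_oracles Oc) (adv_prog A) attack_inputs))) Oc}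
        \<in> events"
      by (simp add: pred_def)
  qed
  finally show ?thesis by simp
qed

text \<open>No abort together with a valid forgery, as a predicate of the result of the run and of
  the oracle, which is the shape that \<open>measurable_run_compose\<close> handles.\<close>

definition forges :: "nat \<times> transcript \<times> store \<Rightarrow> (bits \<Rightarrow> bits \<times> nat) \<Rightarrow> bool" where
  "forges v Oc \<longleftrightarrow> (case v of (t, \<tau>, s) \<Rightarrow> unmarked \<tau> Oc \<and> s 0 \<notin> set (signed \<tau>) \<and>
     s 1 \<in> D \<and> tdp_eval F1 pk (s 1) = hash (Oc (s 0)))"

lemma pred_forges: "Measurable.pred (random_oracle d) (forges v)"
proof -
  obtain t \<tau> s where v: "v = (t, \<tau>, s)" by (cases v)
  show ?thesis unfolding forges_def v prod.case
    by (intro pred_intros_logic pred_unmarked pred_query[where Q = "\<lambda>c. tdp_eval F1 pk (s 1) = hash c"]) simp_all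
qed

text \<open>
  The forged message is not signed, so the only thing that the run and the validity of the forgery
  reveal about it is its hash value, and it is marked with conditional probability \<open>1 / k\<close>.
\<close>

lemma prob_forges_marked_ge:
  "1 / real k * measure (random_oracle oc) {Oc. forges (run (sim_oracles Oc) (adv_prog A) attack_inputs) Oc}
    \<le> measure (random_oracle oc) {Oc. forges (run (sim_oracles Oc) (adv_prog A) attack_inputs) Oc \<and>
        is_claw F1 F2 pk (snd (snd (run (sim_oracles Oc) (adv_prog A) attack_inputs)) 1)
          (fst (Oc (snd (snd (run (sim_oracles Oc) (adv_prog A) attack_inputs)) 0)))}"
proof -
  interpret prob_space "random_oracle oc" by (rule prob_space_random_oracle)
  let ?run = "\<lambda>Oc. run (sim_oracles Oc) (adv_prog A) attack_inputs"
  let ?rot = "run_of_trace (adv_prog A) attack_inputs"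
  let ?solves = "\<lambda>v Oc. is_claw F1 F2 pk (snd (snd v) 1) (fst (Oc (snd (snd v) 0)))"
  \<comment> \<open>Without halting, the run is unspecified and nothing is known about its forgery.
    Both \<open>B\<close> and \<open>G\<close> are true there; the case has probability 0.\<close>
  define B where "B \<kappa> Oc \<longleftrightarrow> \<kappa> = None \<or> forges (?rot \<kappa>) Oc" for \<kappa> Oc
  define G where "G \<kappa> Oc \<longleftrightarrow> \<kappa> = None \<or> forges (?rot \<kappa>) Oc \<and> snd (Oc (snd (snd (?rot \<kappa>)) 0)) = 1" for \<kappa> Oc
  have B: "Measurable.pred (random_oracle oc) (B \<kappa>)" for \<kappa>
    unfolding B_def by (intro pred_intros_logic pred_forges) simp
  have G: "Measurable.pred (random_oracle oc) (G \<kappa>)" for \<kappa>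
    unfolding G_def
    by (intro pred_intros_logic pred_forges pred_query[where Q = "\<lambda>c. snd c = 1"]) simp
  have c: "0 \<le> 1 / real k" "1 / real k \<le> 1" using k_pos by auto
  have le: "1 / real k * prob {Oc. sim_trace Oc = \<kappa> \<and> B \<kappa> Oc} \<le> prob {Oc. sim_trace Oc = \<kappa> \<and> G \<kappa> Oc}" for \<kappa>
  proof (cases "\<exists>\<tau> Oc'. \<kappa> = Some \<tau> \<and> sim_trace Oc' = Some \<tau> \<and> B \<kappa> Oc'")
    case True
    then obtain \<tau> Oc' where \<kappa>: "\<kappa> = Some \<tau>" and Oc': "sim_trace Oc' = Some \<tau>" "B \<kappa> Oc'" by blast
    obtain t \<upsilon> s where rot: "?rot \<kappa> = (t, \<upsilon>, s)" by (cases "?rot \<kappa>")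
    have run: "?rot \<kappa> = ?run Oc'" using run_of_trace[of "adv_prog A" attack_inputs "sim_oracles Oc'"] Oc'(1) \<kappa> by simp
    have "fst (snd (?rot \<kappa>)) = \<tau>" unfolding run by (rule trace_run[OF Oc'(1)])
    then have "\<upsilon> = \<tau>" by (simp add: rot)
    note rot = rot[unfolded this]
    \<comment> \<open>These two parts of \<open>forges\<close> depend on the run alone, so one
      oracle with this transcript decides them for all.\<close>
    have s: "s 0 \<notin> set (signed \<tau>)" "s 1 \<in> D"
      using Oc'(2) by (auto simp: B_def \<kappa> rot[unfolded \<kappa>] forges_def)
    \<comment> \<open>The forged message need not have been queried, so its point is added.\<close>
    define J where "J = insert (s 0) ((fst \<circ> snd) ` set \<tau>)"
    define C where "C r = {c. (\<forall>i y. (i, r, y) \<in> set \<tau> \<longrightarrow> answer hash sim_sig i c = y) \<and>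
      (r \<in> set (signed \<tau>) \<longrightarrow> snd c \<noteq> 1) \<and> (r = s 0 \<longrightarrow> tdp_eval F1 pk (s 1) = hash c)}" for r
    \<comment> \<open>The condition at the forged message in terms of its hash value. As the message
      was not signed, no answer of the signing oracle occurs at this point, and
      \<open>\<lambda>_. []\<close> is a dummy.\<close>
    define V where "V = {h. (\<forall>i y. (i, s 0, y) \<in> set \<tau> \<longrightarrow> answer (\<lambda>h. h) (\<lambda>_. []) i h = y) \<and>
      tdp_eval F1 pk (s 1) = h}"
    have i: "i \<noteq> 1" if "(i, s 0, y) \<in> set \<tau>" for i y using that s(1) set_signed by blast
    have C: "C (s 0) = hash -` V"
      unfolding C_def V_def using s(1) i by (auto simp: answer_def)
    have trace: "sim_trace Oc = Some \<tau> \<longleftrightarrow>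
        (\<forall>r \<in> (fst \<circ> snd) ` set \<tau>. Oc r \<in> {c. \<forall>i y. (i, r, y) \<in> set \<tau> \<longrightarrow> answer hash sim_sig i c = y})" for Oc
      by (rule trace_answer_iff[where ans = "answer hash sim_sig", OF Oc'(1)])
    have J: "finite J" "{s 0} \<subseteq> J" "set (signed \<tau>) \<subseteq> J"
      by (force simp: J_def set_signed)+
    have event: "sim_trace Oc = \<kappa> \<and> B \<kappa> Oc \<longleftrightarrow> (\<forall>r \<in> J. Oc r \<in> C r)" for Oc
    proof -
      have "B \<kappa> Oc \<longleftrightarrow> unmarked \<tau> Oc \<and> tdp_eval F1 pk (s 1) = hash (Oc (s 0))"
        using s by (simp add: B_def \<kappa> rot[unfolded \<kappa>] forges_def)
      moreover have "unmarked \<tau> Oc \<longleftrightarrow> (\<forall>r \<in> J. r \<in> set (signed \<tau>) \<longrightarrow> snd (Oc r) \<noteq> 1)"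
        using J(3) by blast
      moreover have "sim_trace Oc = \<kappa> \<longleftrightarrow> (\<forall>r \<in> J. \<forall>i y. (i, r, y) \<in> set \<tau> \<longrightarrow> answer hash sim_sig i (Oc r) = y)"
        unfolding \<kappa> trace J_def by force
      moreover have "tdp_eval F1 pk (s 1) = hash (Oc (s 0)) \<longleftrightarrow>
          (\<forall>r \<in> J. r = s 0 \<longrightarrow> tdp_eval F1 pk (s 1) = hash (Oc r))"
        using J(2) by blast
      ultimately show ?thesis unfolding C_def by blast
    qed
    have "1 / real k * prob {Oc. sim_trace Oc = \<kappa> \<and> B \<kappa> Oc}
        = (1 / real k) ^ card {s 0} * prob {Oc. \<forall>r \<in> J. Oc r \<in> C r}"
      unfolding event by simp
    also have "\<dots> \<le> prob {Oc. \<forall>r \<in> J. Oc r \<in> C r \<and> (r \<in> {s 0} \<longrightarrow> Oc r \<in> {c. snd c = 1})}"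
      by (rule measure_cylinder_restrict_ge[OF J(1,2) c(1)]) (use C prob_marked_given_hash in simp)
    also have "{Oc. \<forall>r \<in> J. Oc r \<in> C r \<and> (r \<in> {s 0} \<longrightarrow> Oc r \<in> {c. snd c = 1})}
        = {Oc. sim_trace Oc = \<kappa> \<and> G \<kappa> Oc}"
    proof -
      have "G \<kappa> Oc \<longleftrightarrow> B \<kappa> Oc \<and> snd (Oc (s 0)) = 1" for Oc
        by (simp add: G_def B_def \<kappa> rot[unfolded \<kappa>])
      then have "sim_trace Oc = \<kappa> \<and> G \<kappa> Oc \<longleftrightarrow> (\<forall>r \<in> J. Oc r \<in> C r) \<and> snd (Oc (s 0)) = 1" for Oc
        using event[of Oc] by blast
      then show ?thesis using J(2) by auto
    qed
    finally show ?thesis .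
  next
    case False
    show ?thesis
    proof (cases \<kappa>)
      case None
      then show ?thesis
        using mult_left_le_one_le[OF measure_nonneg c, of "random_oracle oc" "{Oc. sim_trace Oc = None}"]
        by (simp add: B_def G_def)
    next
      case (Some \<tau>)
      then have "{Oc. sim_trace Oc = \<kappa> \<and> B \<kappa> Oc} = {}" using False by blast
      then show ?thesis by (simp only: measure_empty mult_zero_right measure_nonneg)
    qed
  qed
  have "1 / real k * prob {Oc. forges (?run Oc) Oc}
      \<le> 1 / real k * prob {Oc \<in> space (random_oracle oc). B (sim_trace Oc) Oc}"
  proof (rule mult_left_mono[OF finite_measure_mono c(1)])
    show "{Oc. forges (?run Oc) Oc} \<subseteq> {Oc \<in> space (random_oracle oc). B (sim_trace Oc) Oc}"
      by (auto simp: B_def run_of_trace)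
    show "{Oc \<in> space (random_oracle oc). B (sim_trace Oc) Oc} \<in> events"
      unfolding pred_def[symmetric] by (rule measurable_compose_countable[OF B measurable_trace_answer])
  qed
  also have "\<dots> \<le> prob {Oc \<in> space (random_oracle oc). G (sim_trace Oc) Oc}"
    by (rule measure_countable_cases_ge[OF measurable_trace_answer G B c(1)]) (use le in simp)
  also have "\<dots> \<le> prob {Oc. forges (?run Oc) Oc \<and> ?solves (?run Oc) Oc}"
  proof (rule finite_measure_mono_AE)
    show "AE Oc in random_oracle oc. Oc \<in> {Oc \<in> space (random_oracle oc). G (sim_trace Oc) Oc} \<longrightarrow>
        Oc \<in> {Oc. forges (?run Oc) Oc \<and> ?solves (?run Oc) Oc}"
      using AE_oc
    proof eventually_elim
      case (elim Oc)
      have "forges (?run Oc) Oc \<and> ?solves (?run Oc) Oc" if g: "G (sim_trace Oc) Oc"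
      proof -
        obtain t \<tau> s where v: "?run Oc = (t, \<tau>, s)" by (cases "?run Oc")
        have "sim_trace Oc \<noteq> None" using trace_not_None(1) elim by blast
        then have f: "forges (?run Oc) Oc" and b: "snd (Oc (s 0)) = 1"
          using g by (auto simp: G_def run_of_trace v)
        have "fst (Oc (s 0)) \<in> D" using elim by (simp add: mem_Times_iff)
        with f b show ?thesis
          by (auto simp: v forges_def is_claw_def dom2 claw_hash_def)
      qed
      then show ?case by blast
    qed
    have "Measurable.pred (random_oracle oc) (\<lambda>Oc. forges (?run Oc) Oc \<and> ?solves (?run Oc) Oc)"
      by (rule measurable_run_compose[where G = "\<lambda>v Oc. forges v Oc \<and> ?solves v Oc"])
        (rule measurable_query_compose, rule pred_intros_logic, rule pred_forges, rule pred_query)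
    then show "{Oc. forges (?run Oc) Oc \<and> ?solves (?run Oc) Oc} \<in> events"
      by (simp add: pred_def)
  qed
  finally show ?thesis .
qed

end

section \<open>Averaging over keys and coins\<close>

lemma integrable_game:
  "integrable (measure_pmf Q) (\<lambda>(x, \<rho>). measure (random_oracle (d x)) (E x \<rho>))"
proof (rule measure_pmf.integrable_const_bound[where B = 1])
  show "AE y in measure_pmf Q. norm (case y of (x, \<rho>) \<Rightarrow> measure (random_oracle (d x)) (E x \<rho>)) \<le> 1"
    using prob_space.prob_le_1[OF prob_space_random_oracle] by (auto simp: case_prod_beta)
qed simp

text \<open>The comparison may be made for each instance and coin string in the support, where the
  estimates for one fixed attack apply.\<close>

lemma game_prob_mono:
  assumes "\<And>x \<rho>. x \<in> set_pmf (pr_inst P n) \<Longrightarrow> \<rho> \<in> set_pmf (coins A n) \<Longrightarrow>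
    c * measure (random_oracle (rd_oc R n x)) {Oc. E x \<rho> Oc} \<le> measure (random_oracle (rd_oc R n x)) {Oc. E' x \<rho> Oc}"
  shows "c * game_prob P R A n E \<le> game_prob P R A n E'"
proof -
  let ?Q = "pair_pmf (pr_inst P n) (coins A n)"
  have "c * game_prob P R A n E
      = (\<integral>y. c * (case y of (x, \<rho>) \<Rightarrow> measure (random_oracle (rd_oc R n x)) {Oc. E x \<rho> Oc}) \<partial>measure_pmf ?Q)"
    unfolding game_prob_def by (rule integral_mult_right_zero[symmetric])
  also have "\<dots> \<le> game_prob P R A n E'"
    unfolding game_prob_def
  proof (rule integral_mono_AE)
    show "AE y in measure_pmf ?Q. c * (case y of (x, \<rho>) \<Rightarrow> measure (random_oracle (rd_oc R n x)) {Oc. E x \<rho> Oc})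
        \<le> (case y of (x, \<rho>) \<Rightarrow> measure (random_oracle (rd_oc R n x)) {Oc. E' x \<rho> Oc})"
      using assms by (auto simp: AE_measure_pmf_iff)
  qed (intro integrable_mult_right integrable_game)+
  finally show ?thesis .
qed

lemma game_prob_True: "game_prob P R A n (\<lambda>x \<rho> Oc. True) = 1"
proof -
  have "measure (random_oracle d) UNIV = 1" for d :: "'a pmf"
    using prob_space.prob_space[OF prob_space_random_oracle[of d]] by simp
  then show ?thesis by (simp add: game_prob_def case_prod_unfold)
qed

context claw_attack
begin

lemma sim_run_claw:
  "sim_run (claw_reduction F1 F2 p) A n pk \<rho> Oc = run (sim_oracles Oc) (adv_prog A) attack_inputs"
proof -
  have "(\<lambda>m. case (if snd (Oc m) \<noteq> 1 then Some (fst (Oc m)) else None) of None \<Rightarrow> [] | Some \<sigma> \<Rightarrow> \<sigma>)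
      = (\<lambda>m. sim_sig (Oc m))"
    by (auto simp: sim_sig_def)
  then show ?thesis
    unfolding sim_run_def claw_reduction_simps prod.case by (simp only: forger_oracles_answer)
qed

lemma no_abort_iff:
  "no_abort (claw_reduction F1 F2 p) A n pk \<rho> Oc
    \<longleftrightarrow> unmarked (fst (snd (run (sim_oracles Oc) (adv_prog A) attack_inputs))) Oc"
  by (simp add: no_abort_def sim_run_claw case_prod_beta)

lemma no_abort_valid_forgery_iff:
  "no_abort (claw_reduction F1 F2 p) A n pk \<rho> Oc \<and> valid_forgery (fdh F1) (claw_reduction F1 F2 p) A n pk \<rho> Oc
    \<longleftrightarrow> forges (run (sim_oracles Oc) (adv_prog A) attack_inputs) Oc"
  by (simp add: no_abort_iff valid_forgery_def sim_run_claw forges_def case_prod_beta)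

lemma solves_problem_iff:
  "solves_problem (claw_problem F1 F2) (claw_reduction F1 F2 p) A n pk \<rho> Oc
    \<longleftrightarrow> is_claw F1 F2 pk (snd (snd (run (sim_oracles Oc) (adv_prog A) attack_inputs)) 1)
          (fst (Oc (snd (snd (run (sim_oracles Oc) (adv_prog A) attack_inputs)) 0)))"
  by (simp add: solves_problem_def sim_run_claw case_prod_beta)

text \<open>\<open>hash\<close> composed with \<open>Oc\<close> takes values in the domain and
  \<open>real_oracles\<close> returns its correct signatures, so this is one of the genuine attacks
  that \<open>signing_queries_le\<close> speaks of.\<close>

lemma signing_queries_real_trace:
  assumes "signing_queries_le (fdh F1) A q" "\<rho> \<in> set_pmf (coins A n)"
    and Oc: "\<And>r. Oc r \<in> D \<times> {1..k}" and \<tau>: "real_trace Oc = Some \<tau>"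
  shows "length (signed \<tau>) \<le> q n"
proof -
  have "\<forall>n. \<forall>(sk, pk) \<in> set_pmf (tdp_gen F1 n). \<forall>\<rho> \<in> set_pmf (coins A n). \<forall>H Sg.
        (\<forall>r. H r \<in> tdp_dom F1 pk) \<longrightarrow> (\<forall>m. Sg m \<in> set_pmf (return_pmf (tdp_inv F1 sk (H m)))) \<longrightarrow>
        (case run (forger_oracles H Sg) (adv_prog A) [unary n, pk, \<rho>] of
           (t, \<tau>, s) \<Rightarrow> length (signed \<tau>) \<le> q n)"
    using assms(1) unfolding signing_queries_le_def fdh_simps .
  from bspec[OF spec[OF this, of n] key]
  have bound: "\<forall>\<rho> \<in> set_pmf (coins A n). \<forall>H Sg.
        (\<forall>r. H r \<in> D) \<longrightarrow> (\<forall>m. Sg m \<in> set_pmf (return_pmf (tdp_inv F1 sk (H m)))) \<longrightarrow>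
        (case run (forger_oracles H Sg) (adv_prog A) [unary n, pk, \<rho>] of
           (t, \<tau>, s) \<Rightarrow> length (signed \<tau>) \<le> q n)"
    unfolding prod.case .
  have "case run (forger_oracles (\<lambda>r. hash (Oc r)) (\<lambda>m. tdp_inv F1 sk (hash (Oc m))))
        (adv_prog A) [unary n, pk, \<rho>] of (t, \<tau>, s) \<Rightarrow> length (signed \<tau>) \<le> q n"
    by (rule bspec[OF bound assms(2), rule_format]) (rule hash_in_dom[OF Oc], simp)
  then show ?thesis
    unfolding forger_oracles_answer[where u = hash and Oc = Oc and v = "\<lambda>c. tdp_inv F1 sk (hash c)"]
    using trace_run[OF \<tau>] by (simp add: case_prod_beta)
qed

end

lemma hf_no_abort_claw:
  assumes claw: "claw_free_pair F1 F2" and p: "\<And>n. 1 \<le> p n" "\<And>n. 2 * q n \<le> p n"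
    and A: "ppt_adversary A" "signing_queries_le (fdh F1) A q"
  shows "hf_no_abort (claw_problem F1 F2) (claw_reduction F1 F2 p) A"
proof -
  let ?R = "claw_reduction F1 F2 p" and ?P = "claw_problem F1 F2"
  have half: "1 / 2 \<le> game_prob ?P ?R A n (no_abort ?R A n)" for n
  proof -
    \<comment> \<open>The sure event has probability 1, which brings the constant bound into the
      form of \<open>game_prob_mono\<close>.\<close>
    have "1 / 2 * game_prob ?P ?R A n (\<lambda>x \<rho> Oc. True) \<le> game_prob ?P ?R A n (no_abort ?R A n)"
    proof (rule game_prob_mono)
      fix x \<rho> assume x: "x \<in> set_pmf (pr_inst ?P n)" and \<rho>: "\<rho> \<in> set_pmf (coins A n)"
      obtain sk where "(sk, x) \<in> set_pmf (tdp_gen F1 n)" using x by (rule pr_inst_key)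
      then interpret claw_attack F1 F2 n sk x "p n" A \<rho> using claw p A by unfold_locales
      interpret O: prob_space "random_oracle (rd_oc ?R n x)" by (rule prob_space_random_oracle)
      have "1 / 2 * measure (random_oracle (rd_oc ?R n x)) {Oc. True} \<le> 1 / 2" using O.prob_le_1 by simp
      \<comment> \<open>\<open>1 - q/p\<close> is the lower bound that Bernoulli's inequality gives
        for the power, and \<open>p\<close> is at least \<open>2 * q\<close>.\<close>
      also have "1 / 2 \<le> 1 + real (q n) * (- 1 / real (p n))"
      proof -
        have "2 * real (q n) \<le> real (p n)" using p(2)[of n] by linarith
        then show ?thesis using p(1)[of n] by (simp add: field_simps)
      qed
      also have "\<dots> \<le> (1 + - 1 / real (p n)) ^ q n"
        by (rule Bernoulli_inequality) (use p(1)[of n] in \<open>simp add: field_simps\<close>)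
      also have "\<dots> = (1 - 1 / real (p n)) ^ q n" by simp
      also have "\<dots> \<le> measure (random_oracle oc)
          {Oc. unmarked (fst (snd (run (sim_oracles Oc) (adv_prog A) attack_inputs))) Oc}"
        by (rule prob_unmarked_ge) (rule signing_queries_real_trace[OF A(2) \<rho>])
      finally show "1 / 2 * measure (random_oracle (rd_oc ?R n x)) {Oc. True}
          \<le> measure (random_oracle (rd_oc ?R n x)) {Oc. no_abort ?R A n x \<rho> Oc}"
        by (simp only: no_abort_iff claw_reduction_simps)
    qed
    then show ?thesis by (simp add: game_prob_True)
  qed
  have "\<forall>\<^sub>F n in sequentially. game_prob ?P ?R A n (no_abort ?R A n) \<ge> 1 / real n ^ 1"
    using eventually_ge_at_top[of 2]
  proof eventually_elim
    case (elim n)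
    then have "1 / real n ^ 1 \<le> 1 / 2" by (simp add: field_simps)
    with half[of n] show ?case by linarith
  qed
  then show ?thesis unfolding hf_no_abort_def non_negligible_def by blast
qed

text \<open>The factor \<open>1/p\<close> of \<open>prob_forges_marked_ge\<close> is the same for
  all keys and coins, and it is non-negligible because \<open>p\<close> is a polynomial.\<close>

lemma hf_finish_claw:
  fixes p :: "nat poly"
  assumes claw: "claw_free_pair F1 F2" and p: "\<And>n. 1 \<le> poly p n" and A: "ppt_adversary A"
  shows "hf_finish (fdh F1) (claw_problem F1 F2) (claw_reduction F1 F2 (poly p)) A"
  unfolding hf_finish_def
proof (intro exI conjI allI)
  let ?R = "claw_reduction F1 F2 (poly p)" and ?P = "claw_problem F1 F2"
  show "non_negligible (\<lambda>n. 1 / real (poly p n))" by (rule non_negligible_inverse_poly[OF p])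
  fix n
  show "1 / real (poly p n) * game_prob ?P ?R A n
        (\<lambda>x \<rho> Oc. no_abort ?R A n x \<rho> Oc \<and> valid_forgery (fdh F1) ?R A n x \<rho> Oc)
      \<le> game_prob ?P ?R A n (\<lambda>x \<rho> Oc. no_abort ?R A n x \<rho> Oc \<and> valid_forgery (fdh F1) ?R A n x \<rho> Oc \<and>
          solves_problem ?P ?R A n x \<rho> Oc)"
  proof (rule game_prob_mono)
    fix x \<rho> assume x: "x \<in> set_pmf (pr_inst ?P n)"
    obtain sk where "(sk, x) \<in> set_pmf (tdp_gen F1 n)" using x by (rule pr_inst_key)
    then interpret claw_attack F1 F2 n sk x "poly p n" A \<rho> using claw p A by unfold_locales
    show "1 / real (poly p n) * measure (random_oracle (rd_oc ?R n x))
          {Oc. no_abort ?R A n x \<rho> Oc \<and> valid_forgery (fdh F1) ?R A n x \<rho> Oc}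
        \<le> measure (random_oracle (rd_oc ?R n x))
          {Oc. no_abort ?R A n x \<rho> Oc \<and> valid_forgery (fdh F1) ?R A n x \<rho> Oc \<and> solves_problem ?P ?R A n x \<rho> Oc}"
      unfolding conj_assoc[symmetric] no_abort_valid_forgery_iff solves_problem_iff claw_reduction_simps
      by (rule prob_forges_marked_ge)
  qed
qed


section \<open>Running time\<close>

lemma set_uniform_bits: "set_pmf (uniform_bits m) = {\<rho>. length \<rho> = m}"
proof -
  have "{\<rho> :: bits. length \<rho> = m} = {\<rho>. set \<rho> \<subseteq> UNIV \<and> length \<rho> = m}" by simp
  then have "finite {\<rho> :: bits. length \<rho> = m}"
    using finite_lists_length_eq[of "UNIV :: bool set" m] by simp
  moreover have "{\<rho> :: bits. length \<rho> = m} \<noteq> {}"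
    using length_replicate[of m True] by blast
  ultimately show ?thesis unfolding uniform_bits_def by (intro set_pmf_of_set)
qed

lemma length_unary [simp]: "length (unary n) = n"
  by (simp add: unary_def)

text \<open>The definition of a trapdoor permutation bounds explicitly the length of domain elements
  only; keys are short because the generator has no time to write longer ones.\<close>

lemma public_key_length:
  assumes "ppt_generator G"
  obtains l :: "nat poly" where "\<And>n sk pk. (sk, pk) \<in> set_pmf (G n) \<Longrightarrow> length pk \<le> poly l n"
proof -
  obtain c :: "nat poly" and g :: "nat \<Rightarrow> bits \<Rightarrow> bits \<times> bits" where
    g: "poly_time_computable {([unary n, \<rho>], [fst (g n \<rho>), snd (g n \<rho>)]) | n \<rho>. length \<rho> = poly c n}"
      (is "poly_time_computable ?F")
    and G: "\<And>n. G n = map_pmf (g n) (uniform_bits (poly c n))"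
    using assms unfolding ppt_generator_def by blast
  obtain P where P: "solves_in_poly_time P {(no_oracles, ins, outs) | ins outs. (ins, outs) \<in> ?F}"
    using g unfolding poly_time_computable_def by blast
  show thesis
  proof (rule solves_in_poly_time_exec[OF P])
    fix T :: "nat poly"
    assume T: "\<And>\<Omega> ins outs L. (\<Omega>, ins, outs) \<in> {(no_oracles, ins, outs) | ins outs. (ins, outs) \<in> ?F} \<Longrightarrow>
       (\<And>i r. length (\<Omega> i r) \<le> L) \<Longrightarrow>
       \<exists>t \<tau> s. exec \<Omega> P (init_store ins) t \<tau> s \<and> map s [0..<length outs] = outs \<and>
         t \<le> poly T ((\<Sum>x\<leftarrow>ins. length x) + L)"
    \<comment> \<open>The lengths of the inputs \<open>unary n\<close> and the \<open>c\<close>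
      coins, plus the running time on them.\<close>
    define l where "l = [:0, 1:] + c + pcompose T ([:0, 1:] + c)"
    show thesis
    proof (rule that[of l])
      fix n sk pk assume "(sk, pk) \<in> set_pmf (G n)"
      then obtain \<rho> where \<rho>: "length \<rho> = poly c n" and pk: "pk = snd (g n \<rho>)"
        by (auto simp: G set_uniform_bits) (metis snd_conv)
      have "(no_oracles, [unary n, \<rho>], [fst (g n \<rho>), snd (g n \<rho>)])
          \<in> {(no_oracles, ins, outs) | ins outs. (ins, outs) \<in> ?F}"
        using \<rho> by blast
      then have "\<exists>t \<tau> s. exec no_oracles P (init_store [unary n, \<rho>]) t \<tau> s \<and>
          map s [0..<length [fst (g n \<rho>), snd (g n \<rho>)]] = [fst (g n \<rho>), snd (g n \<rho>)] \<and>
          t \<le> poly T ((\<Sum>x\<leftarrow>[unary n, \<rho>]. length x) + 0)"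
        by (rule T) (simp add: no_oracles_def)
      then show "length pk \<le> poly l n"
      proof (elim exE conjE)
        fix t \<tau> s assume e: "exec no_oracles P (init_store [unary n, \<rho>]) t \<tau> s"
          and s: "map s [0..<length [fst (g n \<rho>), snd (g n \<rho>)]] = [fst (g n \<rho>), snd (g n \<rho>)]"
          and t: "t \<le> poly T ((\<Sum>x\<leftarrow>[unary n, \<rho>]. length x) + 0)"
        have "length (s 1) \<le> (n + poly c n) + t"
          by (rule exec_store_length[OF e]) (auto simp: init_store_simps \<rho>)
        moreover have "s 1 = pk" using s pk by (simp add: upt_rec)
        ultimately show "length pk \<le> poly l n" using t by (simp add: l_def poly_pcompose \<rho>)
      qed
    qed
  qed
qed

lemma tdp_eval_prog:
  assumes "trapdoor_permutation F"
  obtains P and T :: "nat poly" where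
    "\<And>\<Omega> n sk pk x. (sk, pk) \<in> set_pmf (tdp_gen F n) \<Longrightarrow> x \<in> tdp_dom F pk \<Longrightarrow>
       \<exists>t s. exec \<Omega> P (init_store [unary n, pk, x]) t [] s \<and> s 0 = tdp_eval F pk x \<and>
         t \<le> poly T (n + length pk + length x)"
proof -
  have "poly_time_computable {([unary n, pk, x], [tdp_eval F pk x]) | n sk pk x.
          (sk, pk) \<in> set_pmf (tdp_gen F n) \<and> x \<in> tdp_dom F pk}" (is "poly_time_computable ?F")
    using assms unfolding trapdoor_permutation_def by (elim conjE)
  then obtain P where free: "ask_free P"
    and P: "solves_in_poly_time P {(no_oracles, ins, outs) | ins outs. (ins, outs) \<in> ?F}"
    unfolding poly_time_computable_def by blast
  show thesis
  proof (rule solves_in_poly_time_exec[OF P])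
    fix T :: "nat poly"
    assume T: "\<And>\<Omega> ins outs L. (\<Omega>, ins, outs) \<in> {(no_oracles, ins, outs) | ins outs. (ins, outs) \<in> ?F} \<Longrightarrow>
       (\<And>i r. length (\<Omega> i r) \<le> L) \<Longrightarrow>
       \<exists>t \<tau> s. exec \<Omega> P (init_store ins) t \<tau> s \<and> map s [0..<length outs] = outs \<and>
         t \<le> poly T ((\<Sum>x\<leftarrow>ins. length x) + L)"
    show thesis
    proof (rule that[of P T])
      fix \<Omega> n sk pk x
      assume "(sk, pk) \<in> set_pmf (tdp_gen F n)" "x \<in> tdp_dom F pk"
      then have "(no_oracles, [unary n, pk, x], [tdp_eval F pk x])
          \<in> {(no_oracles, ins, outs) | ins outs. (ins, outs) \<in> ?F}"
        by blast
      then have "\<exists>t \<tau> s. exec no_oracles P (init_store [unary n, pk, x]) t \<tau> s \<and>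
          map s [0..<length [tdp_eval F pk x]] = [tdp_eval F pk x] \<and>
          t \<le> poly T ((\<Sum>x\<leftarrow>[unary n, pk, x]. length x) + 0)"
        by (rule T) (simp add: no_oracles_def)
      then show "\<exists>t s. exec \<Omega> P (init_store [unary n, pk, x]) t [] s \<and> s 0 = tdp_eval F pk x \<and>
         t \<le> poly T (n + length pk + length x)"
      proof (elim exE conjE)
        fix t \<tau> s assume e: "exec no_oracles P (init_store [unary n, pk, x]) t \<tau> s"
          and s: "map s [0..<length [tdp_eval F pk x]] = [tdp_eval F pk x]"
          and t: "t \<le> poly T ((\<Sum>x\<leftarrow>[unary n, pk, x]. length x) + 0)"
        have "exec \<Omega> P (init_store [unary n, pk, x]) t [] s" by (rule exec_ask_free_cong[OF e free])
        moreover have "s 0 = tdp_eval F pk x" using s by simp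
        moreover have "t \<le> poly T (n + length pk + length x)" using t by (simp add: add.assoc)
        ultimately show ?thesis by blast
      qed
    qed
  qed
qed

lemma solves_in_poly_timeI:
  fixes T :: "nat poly"
  assumes "\<And>\<Omega> ins outs L. (\<Omega>, ins, outs) \<in> J \<Longrightarrow> (\<And>i r. length (\<Omega> i r) \<le> L) \<Longrightarrow>
       \<exists>t \<tau> s. exec \<Omega> P (init_store ins) t \<tau> s \<and> map s [0..<length outs] = outs \<and>
         t \<le> poly T ((\<Sum>x\<leftarrow>ins. length x) + L)"
  shows "solves_in_poly_time P J"
  unfolding solves_in_poly_time_def
proof (intro exI[of _ T] ballI)
  fix j assume "j \<in> J"
  then show "case j of (\<Omega>, ins, outs) \<Rightarrow> \<forall>L. (\<forall>i r. length (\<Omega> i r) \<le> L) \<longrightarrow>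
        (\<exists>t \<tau> s. exec \<Omega> P (init_store ins) t \<tau> s \<and> map s [0..<length outs] = outs \<and>
                 t \<le> poly T ((\<Sum>x\<leftarrow>ins. length x) + L))"
    using assms by (cases j) simp
qed

lemma sum_list_bound:
  assumes "\<And>x. x \<in> set xs \<Longrightarrow> f x \<le> (b :: nat)"
  shows "(\<Sum>x\<leftarrow>xs. f x) \<le> length xs * b"
  using sum_list_mono[of xs f "\<lambda>_. b"] assms by (simp add: sum_list_triv)

text \<open>\<open>total_time\<close> is a sum of values of \<open>steps\<close>, so only this part
  of \<open>solves_in_poly_time\<close> is kept.\<close>

definition steps_bound :: "prog \<Rightarrow> (oracles \<times> bits list \<times> bits list) set \<Rightarrow> nat poly \<Rightarrow> bool" where
  "steps_bound P J T \<longleftrightarrow> (\<forall>(\<Omega>, ins, outs) \<in> J. \<forall>L. (\<forall>i r. length (\<Omega> i r) \<le> L) \<longrightarrow>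
     steps \<Omega> P ins \<le> poly T ((\<Sum>x\<leftarrow>ins. length x) + L))"

lemma steps_boundD:
  assumes "steps_bound P J T" "(\<Omega>, ins, outs) \<in> J" "\<And>i r. length (\<Omega> i r) \<le> L"
  shows "steps \<Omega> P ins \<le> poly T ((\<Sum>x\<leftarrow>ins. length x) + L)"
  using bspec[OF assms(1)[unfolded steps_bound_def] assms(2)] assms(3) by simp

lemma solves_in_poly_time_steps:
  assumes "solves_in_poly_time P J"
  shows "\<exists>T. steps_bound P J T"
proof (rule solves_in_poly_time_exec[OF assms])
  fix T :: "nat poly"
  assume T: "\<And>\<Omega> ins outs L. (\<Omega>, ins, outs) \<in> J \<Longrightarrow> (\<And>i r. length (\<Omega> i r) \<le> L) \<Longrightarrow>
       \<exists>t \<tau> s. exec \<Omega> P (init_store ins) t \<tau> s \<and> map s [0..<length outs] = outs \<and>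
         t \<le> poly T ((\<Sum>x\<leftarrow>ins. length x) + L)"
  have "steps_bound P J T"
    unfolding steps_bound_def
  proof clarify
    fix \<Omega> ins outs L
    assume "(\<Omega>, ins, outs) \<in> J" "\<forall>i r. length (\<Omega> i r) \<le> L"
    then obtain t \<tau> s where "exec \<Omega> P (init_store ins) t \<tau> s" "t \<le> poly T ((\<Sum>x\<leftarrow>ins. length x) + L)"
      using T by blast
    then show "steps \<Omega> P ins \<le> poly T ((\<Sum>x\<leftarrow>ins. length x) + L)" by (simp add: steps_eq)
  qed
  then show ?thesis ..
qed

section \<open>Time of the composed algorithm\<close>

context
  fixes F1 F2 :: tdp and p :: "nat poly"
  assumes claw: "claw_free_pair F1 F2" and p: "\<And>n. 1 \<le> poly p n"
begin

abbreviation (input) red :: "(bits \<times> nat) reduction" where "red \<equiv> claw_reduction F1 F2 (poly p)"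
abbreviation (input) pks :: "nat \<Rightarrow> bits set" where "pks n \<equiv> set_pmf (pr_inst (claw_problem F1 F2) n)"

lemma oc_values_claw:
  assumes "pk \<in> pks n" "Oc \<in> oc_values red n pk"
  shows "fst (Oc r) \<in> tdp_dom F1 pk" "1 \<le> snd (Oc r)" "snd (Oc r) \<le> poly p n"
proof -
  obtain sk where "(sk, pk) \<in> set_pmf (tdp_gen F1 n)" using assms(1) by (rule pr_inst_key)
  then interpret claw_pair_key F1 F2 n sk pk "poly p n" using claw p by unfold_locales
  have "Oc r \<in> set_pmf oc" using assms(2) by (simp add: oc_values_def)
  then have "Oc r \<in> tdp_dom F1 pk \<times> {1..poly p n}" by (simp only: set_pmf_oc)
  then show "fst (Oc r) \<in> tdp_dom F1 pk" "1 \<le> snd (Oc r)" "snd (Oc r) \<le> poly p n"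
    by (auto simp: mem_Times_iff)
qed

lemma oc_oracles_claw: "oc_oracles red Oc i r = enc_nat (snd (Oc r)) @ fst (Oc r)"
  by (simp add: oc_oracles_def)

lemma solves_start:
  "solves_in_poly_time (Copy 0 1)
     {(no_oracles, [unary n, x], [fst (rd_start red x), snd (rd_start red x)]) | n x. x \<in> pks n}"
proof (rule solves_in_poly_timeI[of _ _ "[:1, 1:]"])
  fix \<Omega> ins outs L
  assume "(\<Omega>, ins, outs) \<in> {(no_oracles, [unary n, x], [fst (rd_start red x), snd (rd_start red x)]) | n x. x \<in> pks n}"
  then obtain n x where io: "ins = [unary n, x]" "outs = [x, x]" by auto
  have "exec \<Omega> (Copy 0 1) (init_store ins) (1 + length x) [] ((init_store ins)(0 := x))"
    using exec.Copy[of \<Omega> 0 1 "init_store ins"] by (simp add: init_store_simps io)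
  then show "\<exists>t \<tau> s. exec \<Omega> (Copy 0 1) (init_store ins) t \<tau> s \<and> map s [0..<length outs] = outs \<and>
         t \<le> poly [:1, 1:] ((\<Sum>x\<leftarrow>ins. length x) + L)"
    by (intro exI conjI) (assumption, simp_all add: io init_store_simps upt_rec)
qed

lemma solves_rand:
  obtains PR where "solves_in_poly_time PR
    {(oc_oracles red Oc, [unary n, r, snd (rd_start red x)], [rd_rand red Oc r (snd (rd_start red x))]) | n x Oc r.
       x \<in> pks n \<and> Oc \<in> oc_values red n x}"
proof -
  have tdp: "trapdoor_permutation F1" "trapdoor_permutation F2" and gen: "tdp_gen F2 = tdp_gen F1"
    using claw by (simp_all add: claw_free_pair_def)
  show thesis
  proof (rule tdp_eval_prog[OF tdp(1)], rule tdp_eval_prog[OF tdp(2)])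
    fix P1 P2 and T1 T2 :: "nat poly"
    assume T1: "\<And>\<Omega> n sk pk x. (sk, pk) \<in> set_pmf (tdp_gen F1 n) \<Longrightarrow> x \<in> tdp_dom F1 pk \<Longrightarrow>
       \<exists>t s. exec \<Omega> P1 (init_store [unary n, pk, x]) t [] s \<and> s 0 = tdp_eval F1 pk x \<and>
         t \<le> poly T1 (n + length pk + length x)"
    assume T2: "\<And>\<Omega> n sk pk x. (sk, pk) \<in> set_pmf (tdp_gen F2 n) \<Longrightarrow> x \<in> tdp_dom F2 pk \<Longrightarrow>
       \<exists>t s. exec \<Omega> P2 (init_store [unary n, pk, x]) t [] s \<and> s 0 = tdp_eval F2 pk x \<and>
         t \<le> poly T2 (n + length pk + length x)"
    \<comment> \<open>The polynomial \<open>[:20, 4:]\<close> pays for the query and the moves;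
      adding both \<open>T1\<close> and \<open>T2\<close> covers either branch.\<close>
    show thesis
    proof (rule that[of "hash_prog P1 P2"], rule solves_in_poly_timeI[of _ _ "[:20, 4:] + T1 + T2"])
      fix \<Omega> ins outs L
      assume "(\<Omega>, ins, outs) \<in> {(oc_oracles red Oc, [unary n, r, snd (rd_start red x)],
          [rd_rand red Oc r (snd (rd_start red x))]) | n x Oc r. x \<in> pks n \<and> Oc \<in> oc_values red n x}"
        and L: "\<And>i r. length (\<Omega> i r) \<le> L"
      then obtain n x Oc r where \<Omega>: "\<Omega> = oc_oracles red Oc" and ins: "ins = [unary n, r, x]"
        and outs: "outs = [claw_hash F1 F2 x (Oc r)]" and x: "x \<in> pks n" and Oc: "Oc \<in> oc_values red n x"
        unfolding claw_reduction_simps snd_conv by blast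
      obtain sk where sk: "(sk, x) \<in> set_pmf (tdp_gen F1 n)" using x by (rule pr_inst_key)
      then interpret claw_pair_key F1 F2 n sk x "poly p n" using claw p by unfold_locales
      define a b where "a = fst (Oc r)" and "b = snd (Oc r)"
      have a: "a \<in> tdp_dom F1 x" and b: "1 \<le> b"
        using oc_values_claw[OF x Oc] by (simp_all add: a_def b_def)
      have ans: "\<Omega> 0 r = enc_nat b @ a" by (simp add: \<Omega> oc_oracles_claw a_def b_def)
      let ?K = "(\<Sum>x\<leftarrow>ins. length x) + L"
      have "length a \<le> L" using L[of 0 r] by (simp add: ans)
      then have K: "n + length x + length a \<le> ?K" by (simp add: ins)
      have "\<exists>t s. exec \<Omega> (if b = 1 then P2 else P1) (init_store [unary n, x, a]) t [] s \<and>
          s 0 = claw_hash F1 F2 x (Oc r) \<and> t \<le> poly T1 ?K + poly T2 ?K"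
      proof (cases "b = 1")
        case True
        obtain t s where "exec \<Omega> P2 (init_store [unary n, x, a]) t [] s" "s 0 = tdp_eval F2 x a"
          "t \<le> poly T2 (n + length x + length a)"
          using T2[of sk x n a \<Omega>] sk a by (auto simp: gen dom2)
        moreover have "poly T2 (n + length x + length a) \<le> poly T2 ?K" by (rule poly_mono_nat[OF K])
        ultimately show ?thesis using True
          by (intro exI[of _ t] exI[of _ s]) (simp add: claw_hash_def a_def b_def)
      next
        case False
        obtain t s where "exec \<Omega> P1 (init_store [unary n, x, a]) t [] s" "s 0 = tdp_eval F1 x a"
          "t \<le> poly T1 (n + length x + length a)"
          using T1[of sk x n a \<Omega>] sk a by auto
        moreover have "poly T1 (n + length x + length a) \<le> poly T1 ?K" by (rule poly_mono_nat[OF K])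
        ultimately show ?thesis using False
          by (intro exI[of _ t] exI[of _ s]) (simp add: claw_hash_def a_def b_def)
      qed
      then obtain t s where e: "exec \<Omega> (if b = 1 then P2 else P1) (init_store [unary n, x, a]) t [] s"
        and s: "s 0 = claw_hash F1 F2 x (Oc r)" and t: "t \<le> poly T1 ?K + poly T2 ?K" by blast
      obtain u \<upsilon> where u: "exec \<Omega> (hash_prog P1 P2) (init_store [unary n, r, x]) u \<upsilon> s"
        and u_le: "u \<le> 20 + length r + length x + 4 * length (\<Omega> 0 r) + t"
        using exec_hash_prog[OF e ans b] by blast
      have "20 + length r + length x + 4 * length (\<Omega> 0 r) \<le> poly [:20, 4:] ?K"
        using L[of 0 r] by (simp add: ins)
      then have "u \<le> poly ([:20, 4:] + T1 + T2) ?K" using u_le t by (simp only: poly_add)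
      moreover have "map s [0..<length outs] = outs" using s by (simp add: outs)
      ultimately show "\<exists>t \<tau> s. exec \<Omega> (hash_prog P1 P2) (init_store ins) t \<tau> s \<and>
          map s [0..<length outs] = outs \<and> t \<le> poly ([:20, 4:] + T1 + T2) ?K"
        using u unfolding ins by blast
    qed
  qed
qed

lemma solves_sign:
  "solves_in_poly_time sign_prog
    {(oc_oracles red Oc, [unary n, m, snd (rd_start red x)], [enc_opt (rd_sign red Oc m (snd (rd_start red x)))]) | n x Oc m.
       x \<in> pks n \<and> Oc \<in> oc_values red n x}"
proof (rule solves_in_poly_timeI[of _ _ "[:20, 4:]"])
  fix \<Omega> ins outs L
  assume "(\<Omega>, ins, outs) \<in> {(oc_oracles red Oc, [unary n, m, snd (rd_start red x)],
      [enc_opt (rd_sign red Oc m (snd (rd_start red x)))]) | n x Oc m. x \<in> pks n \<and> Oc \<in> oc_values red n x}"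
    and L: "\<And>i r. length (\<Omega> i r) \<le> L"
  then obtain n x Oc m where \<Omega>: "\<Omega> = oc_oracles red Oc" and ins: "ins = [unary n, m, x]"
    and outs: "outs = [enc_opt (if snd (Oc m) \<noteq> 1 then Some (fst (Oc m)) else None)]"
    and x: "x \<in> pks n" and Oc: "Oc \<in> oc_values red n x"
    unfolding claw_reduction_simps snd_conv by blast
  have ans: "\<Omega> 0 m = enc_nat (snd (Oc m)) @ fst (Oc m)" by (simp add: \<Omega> oc_oracles_claw)
  obtain u \<upsilon> s where u: "exec \<Omega> sign_prog (init_store ins) u \<upsilon> s"
    and s: "s 0 = enc_opt (if snd (Oc m) \<noteq> 1 then Some (fst (Oc m)) else None)"
    and u_le: "u \<le> 20 + length m + 4 * length (\<Omega> 0 m)"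
    using exec_sign_prog[where \<Omega> = \<Omega> and x = m and a = "fst (Oc m)", OF ans oc_values_claw(2)[OF x Oc]] unfolding ins by blast
  have "map s [0..<length outs] = outs" unfolding outs by (simp add: s del: enc_opt.simps)
  moreover have "u \<le> poly [:20, 4:] ((\<Sum>x\<leftarrow>ins. length x) + L)"
    using u_le L[of 0 m] by (simp add: ins)
  ultimately show "\<exists>t \<tau> s. exec \<Omega> sign_prog (init_store ins) t \<tau> s \<and> map s [0..<length outs] = outs \<and>
      t \<le> poly [:20, 4:] ((\<Sum>x\<leftarrow>ins. length x) + L)"
    using u by blast
qed

lemma solves_finish:
  "solves_in_poly_time finish_prog
    {(oc_oracles red Oc, [unary n, m, \<sigma>, snd (rd_start red x)], rd_finish red Oc m \<sigma> (snd (rd_start red x))) | n x Oc m \<sigma>.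
       x \<in> pks n \<and> Oc \<in> oc_values red n x}"
proof (rule solves_in_poly_timeI[of _ _ "[:20, 4:]"])
  fix \<Omega> ins outs L
  assume "(\<Omega>, ins, outs) \<in> {(oc_oracles red Oc, [unary n, m, \<sigma>, snd (rd_start red x)],
      rd_finish red Oc m \<sigma> (snd (rd_start red x))) | n x Oc m \<sigma>. x \<in> pks n \<and> Oc \<in> oc_values red n x}"
    and L: "\<And>i r. length (\<Omega> i r) \<le> L"
  then obtain n x Oc m \<sigma> where \<Omega>: "\<Omega> = oc_oracles red Oc" and ins: "ins = [unary n, m, \<sigma>, x]"
    and outs: "outs = [\<sigma>, fst (Oc m)]"
    unfolding claw_reduction_simps snd_conv by blast
  have ans: "\<Omega> 0 m = enc_nat (snd (Oc m)) @ fst (Oc m)" by (simp add: \<Omega> oc_oracles_claw)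
  obtain u \<upsilon> s where u: "exec \<Omega> finish_prog (init_store ins) u \<upsilon> s"
    and s: "s 0 = \<sigma>" "s 1 = fst (Oc m)" and u_le: "u \<le> 20 + length m + length \<sigma> + 4 * length (\<Omega> 0 m)"
    using exec_finish_prog[where \<Omega> = \<Omega> and x = m and a = "fst (Oc m)", OF ans] unfolding ins by blast
  have "map s [0..<length outs] = outs" using s by (simp add: outs upt_rec)
  moreover have "u \<le> poly [:20, 4:] ((\<Sum>x\<leftarrow>ins. length x) + L)"
    using u_le L[of 0 m] by (simp add: ins)
  ultimately show "\<exists>t \<tau> s. exec \<Omega> finish_prog (init_store ins) t \<tau> s \<and> map s [0..<length outs] = outs \<and>
      t \<le> poly [:20, 4:] ((\<Sum>x\<leftarrow>ins. length x) + L)"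
    using u by blast
qed

text \<open>\<open>W\<close> bounds the inputs and the oracle answers, \<open>t0\<close> the time of
  the forger. So there are at most \<open>t0\<close> queries, each of length at most
  \<open>t0\<close>, and both halves of the forgery have length at most \<open>W + t0\<close>. The
  largest input is that of FINISH: three strings or bounds of size \<open>W\<close> and two of size
  \<open>W + t0\<close>, which gives \<open>5 * W + 2 * t0\<close>.\<close>

lemma total_time_le:
  fixes TS TR TG TF TA l :: "nat poly"
  assumes A: "ppt_adversary A"
    and x: "x \<in> pks n" and \<rho>: "\<rho> \<in> set_pmf (coins A n)"
    and Oc: "Oc \<in> oc_values red n x"
    and W: "length x \<le> W" "n \<le> W" "length \<rho> \<le> W"
    and ans: "\<And>i r. length (oc_oracles red Oc i r) \<le> W"
    and TS: "steps no_oracles PS [unary n, x] \<le> poly TS (n + length x)"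
    and TR: "\<And>r. steps (oc_oracles red Oc) PR [unary n, r, x] \<le> poly TR (n + length r + length x + W)"
    and TG: "\<And>r. steps (oc_oracles red Oc) PG [unary n, r, x] \<le> poly TG (n + length r + length x + W)"
    and TF: "\<And>r \<sigma>. steps (oc_oracles red Oc) PF [unary n, r, \<sigma>, x]
      \<le> poly TF (n + length r + length \<sigma> + length x + W)"
    and TA: "\<And>H Sg. (\<And>r. length (H r) \<le> W) \<Longrightarrow> (\<And>r. length (Sg r) \<le> W) \<Longrightarrow>
      \<exists>t \<tau> s. exec (forger_oracles H Sg) (adv_prog A) (init_store [unary n, x, \<rho>]) t \<tau> s \<and> t \<le> t0"
  shows "total_time red A PS PR PG PF n x \<rho> Oc
    \<le> poly TS (5 * W + 2 * t0) + t0 + t0 * (poly TR (5 * W + 2 * t0) + poly TG (5 * W + 2 * t0))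
      + poly TF (5 * W + 2 * t0)"
proof -
  let ?Z = "5 * W + 2 * t0"
  obtain sk where sk: "(sk, x) \<in> set_pmf (tdp_gen F1 n)" using x by (rule pr_inst_key)
  then interpret claw_attack F1 F2 n sk x "poly p n" A \<rho> using claw p A by unfold_locales
  note Oc_dom = oc_values_claw[OF x Oc]
  have c: "Oc r \<in> D \<times> {1..poly p n}" for r
    using Oc_dom[of r] by (simp add: mem_Times_iff)
  \<comment> \<open>All domain elements are as long as the first component of any oracle answer, and
    answers have length at most \<open>W\<close>.\<close>
  have len: "length y \<le> W" if "y \<in> D" for y
  proof -
    have "length (fst (Oc [])) \<le> W" using ans[of 0 "[]"] by (simp add: oc_oracles_claw)
    then show ?thesis using dom_length[OF that Oc_dom(1)[of "[]"]] by simp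
  qed
  have "length (hash (Oc r)) \<le> W" for r by (rule len[OF hash_in_dom[OF c]])
  moreover have "length (sim_sig (Oc r)) \<le> W" for r
    using len[OF Oc_dom(1)] by (simp add: sim_sig_def)
  ultimately obtain t \<tau> s where e: "exec (forger_oracles (\<lambda>r. hash (Oc r)) (\<lambda>r. sim_sig (Oc r))) (adv_prog A)
      (init_store attack_inputs) t \<tau> s" and t: "t \<le> t0"
    using TA[of "\<lambda>r. hash (Oc r)" "\<lambda>r. sim_sig (Oc r)"] by blast
  have run: "sim_run red A n x \<rho> Oc = (t, \<tau>, s)"
    unfolding sim_run_claw using run_eq[OF e]
    unfolding forger_oracles_answer[where u = hash and v = sim_sig and Oc = Oc] .
  have store: "length (s r) \<le> W + t0" for r
  proof -
    have "length (s r) \<le> W + t"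
      by (rule exec_store_length[OF e]) (use W in \<open>auto simp: init_store_simps\<close>)
    then show ?thesis using t by simp
  qed
  have query: "(if i = 0 then steps (oc_oracles red Oc) PR [unary n, r, x]
      else if i = 1 then steps (oc_oracles red Oc) PG [unary n, r, x] else 0) \<le> poly TR ?Z + poly TG ?Z"
    if "(i, r, y) \<in> set \<tau>" for i r y
  proof -
    have "length r \<le> t0" using exec_query_length[OF e that] t by simp
    then have "n + length r + length x + W \<le> ?Z" using W by simp
    then have "steps (oc_oracles red Oc) PR [unary n, r, x] \<le> poly TR ?Z"
      and "steps (oc_oracles red Oc) PG [unary n, r, x] \<le> poly TG ?Z"
      using TR TG poly_mono_nat le_trans by meson+
    then show ?thesis by auto
  qed
  let ?q = "\<Sum>(i, r, y) \<leftarrow> \<tau>. if i = 0 then steps (oc_oracles red Oc) PR [unary n, r, x]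
      else if i = 1 then steps (oc_oracles red Oc) PG [unary n, r, x] else 0"
  have "?q \<le> length \<tau> * (poly TR ?Z + poly TG ?Z)"
    by (rule sum_list_bound) (use query in auto)
  also have "\<dots> \<le> t0 * (poly TR ?Z + poly TG ?Z)"
    using exec_transcript_length[OF e] t by (intro mult_right_mono) auto
  finally have q: "?q \<le> t0 * (poly TR ?Z + poly TG ?Z)" .
  have "n + length x \<le> ?Z" using W by simp
  then have S: "steps no_oracles PS [unary n, x] \<le> poly TS ?Z"
    using TS poly_mono_nat le_trans by meson
  have "n + length (s 0) + length (s 1) + length x + W \<le> ?Z"
    using W store[of 0] store[of 1] by simp
  then have F: "steps (oc_oracles red Oc) PF [unary n, s 0, s 1, x] \<le> poly TF ?Z"
    using TF poly_mono_nat le_trans by meson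
  have "total_time red A PS PR PG PF n x \<rho> Oc
      = steps no_oracles PS [unary n, x] + t + ?q + steps (oc_oracles red Oc) PF [unary n, s 0, s 1, x]"
    unfolding total_time_def run claw_reduction_simps prod.case ..
  then show ?thesis using S t q F by linarith
qed

lemma hf_efficient_claw:
  assumes A: "ppt_adversary A"
  shows "hf_efficient (claw_problem F1 F2) red A"
proof -
  have tdp1: "trapdoor_permutation F1" using claw by (simp add: claw_free_pair_def)
  obtain PR where PR: "solves_in_poly_time PR
    {(oc_oracles red Oc, [unary n, r, snd (rd_start red x)],
        [rd_rand red Oc r (snd (rd_start red x))]) | n x Oc r.
       x \<in> pks n \<and> Oc \<in> oc_values red n x}"
    by (rule solves_rand)
  have "ppt_generator (tdp_gen F1)" using tdp1 by (simp add: trapdoor_permutation_def)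
  then obtain lk :: "nat poly" where lk: "\<And>n sk pk. (sk, pk) \<in> set_pmf (tdp_gen F1 n) \<Longrightarrow> length pk \<le> poly lk n"
    by (rule public_key_length) blast
  have "\<exists>l :: nat poly. \<forall>n. \<forall>(sk, pk) \<in> set_pmf (tdp_gen F1 n). \<forall>x \<in> tdp_dom F1 pk. length x \<le> poly l n"
    using tdp1 unfolding trapdoor_permutation_def by (elim conjE)
  then obtain ld :: "nat poly" where
    ld: "\<forall>n. \<forall>(sk, pk) \<in> set_pmf (tdp_gen F1 n). \<forall>x \<in> tdp_dom F1 pk. length x \<le> poly ld n" ..
  obtain TS where TS: "steps_bound (Copy 0 1) {(no_oracles, [unary n, x],
        [fst (rd_start red x), snd (rd_start red x)]) | n x. x \<in> pks n} TS"
    using solves_in_poly_time_steps[OF solves_start] ..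
  obtain TR where TR: "steps_bound PR {(oc_oracles red Oc, [unary n, r, snd (rd_start red x)],
        [rd_rand red Oc r (snd (rd_start red x))]) | n x Oc r.
        x \<in> pks n \<and> Oc \<in> oc_values red n x} TR"
    using solves_in_poly_time_steps[OF PR] ..
  obtain TG where TG: "steps_bound sign_prog {(oc_oracles red Oc, [unary n, m, snd (rd_start red x)],
        [enc_opt (rd_sign red Oc m (snd (rd_start red x)))]) | n x Oc m.
        x \<in> pks n \<and> Oc \<in> oc_values red n x} TG"
    using solves_in_poly_time_steps[OF solves_sign] ..
  obtain TF where TF: "steps_bound finish_prog {(oc_oracles red Oc, [unary n, m, \<sigma>, snd (rd_start red x)],
        rd_finish red Oc m \<sigma> (snd (rd_start red x))) | n x Oc m \<sigma>.
        x \<in> pks n \<and> Oc \<in> oc_values red n x} TF"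
    using solves_in_poly_time_steps[OF solves_finish] ..
  obtain TA :: "nat poly" where TA: "\<And>H Sg w x y L. (\<And>r. length (H r) \<le> L) \<Longrightarrow> (\<And>r. length (Sg r) \<le> L) \<Longrightarrow>
      \<exists>t \<tau> s. exec (forger_oracles H Sg) (adv_prog A) (init_store [w, x, y]) t \<tau> s \<and>
        t \<le> poly TA (length w + length x + length y + L)"
    using forger_halts[OF A] by blast
  \<comment> \<open>The term \<open>1 + n\<close> covers the security parameter and the separator
    bit of \<open>enc_nat\<close>; the others cover key, coins, domain elements and the unary mark,
    which is at most \<open>p\<close>.\<close>
  define W where "W = [:1, 1:] + lk + adv_coins A + ld + p"
  \<comment> \<open>Three inputs and the length of the answers, each at most
    \<open>W\<close>.\<close>
  define t0 where "t0 = pcompose TA (smult 4 W)"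
  define Z where "Z = smult 5 W + smult 2 t0"
  define T where "T = pcompose TS Z + t0 + t0 * (pcompose TR Z + pcompose TG Z) + pcompose TF Z"
  have "total_time red A (Copy 0 1) PR sign_prog finish_prog n x \<rho> Oc \<le> poly T n"
    if x: "x \<in> pks n" and \<rho>: "\<rho> \<in> set_pmf (coins A n)" and Oc: "Oc \<in> oc_values red n x"
    for n x \<rho> Oc
  proof -
    have Z: "poly Z n = 5 * poly W n + 2 * poly t0 n" by (simp add: Z_def)
    obtain sk where sk: "(sk, x) \<in> set_pmf (tdp_gen F1 n)" using x by (rule pr_inst_key)
    have key: "length x \<le> poly W n" using lk[OF sk] by (simp add: W_def)
    have n: "n \<le> poly W n" by (simp add: W_def)
    have rho: "length \<rho> \<le> poly W n" using \<rho> by (simp add: W_def coins_def set_uniform_bits)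
    have dom: "\<forall>y \<in> tdp_dom F1 x. length y \<le> poly ld n"
      using bspec[OF spec[OF ld, of n] sk] by simp
    have ans: "length (oc_oracles red Oc i r) \<le> poly W n" for i r
      using bspec[OF dom oc_values_claw(1)[OF x Oc, of r]] oc_values_claw(3)[OF x Oc, of r]
      by (simp add: oc_oracles_claw enc_nat_def W_def)
    have "total_time red A (Copy 0 1) PR sign_prog finish_prog n x \<rho> Oc
      \<le> poly TS (5 * poly W n + 2 * poly t0 n) + poly t0 n
        + poly t0 n * (poly TR (5 * poly W n + 2 * poly t0 n) + poly TG (5 * poly W n + 2 * poly t0 n))
        + poly TF (5 * poly W n + 2 * poly t0 n)"
    proof (rule total_time_le[OF A x \<rho> Oc key n rho ans])
      \<comment> \<open>All answers of \<open>no_oracles\<close> are empty, hence the summand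
        0.\<close>
      have "steps no_oracles (Copy 0 1) [unary n, x] \<le> poly TS ((\<Sum>x\<leftarrow>[unary n, x]. length x) + 0)"
        by (rule steps_boundD[OF TS, where outs = "[fst (rd_start red x), snd (rd_start red x)]"])
          (use x in blast, simp add: no_oracles_def)
      then show "steps no_oracles (Copy 0 1) [unary n, x] \<le> poly TS (n + length x)" by simp
      fix r \<sigma>
      have "steps (oc_oracles red Oc) PR [unary n, r, snd (rd_start red x)]
          \<le> poly TR ((\<Sum>x\<leftarrow>[unary n, r, snd (rd_start red x)]. length x) + poly W n)"
        by (rule steps_boundD[OF TR _ ans]) (use x Oc in blast)
      then show "steps (oc_oracles red Oc) PR [unary n, r, x] \<le> poly TR (n + length r + length x + poly W n)"
        by (simp add: add.assoc)
      have "steps (oc_oracles red Oc) sign_prog [unary n, r, snd (rd_start red x)]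
          \<le> poly TG ((\<Sum>x\<leftarrow>[unary n, r, snd (rd_start red x)]. length x) + poly W n)"
        by (rule steps_boundD[OF TG _ ans]) (use x Oc in blast)
      then show "steps (oc_oracles red Oc) sign_prog [unary n, r, x] \<le> poly TG (n + length r + length x + poly W n)"
        by (simp add: add.assoc)
      have "steps (oc_oracles red Oc) finish_prog [unary n, r, \<sigma>, snd (rd_start red x)]
          \<le> poly TF ((\<Sum>x\<leftarrow>[unary n, r, \<sigma>, snd (rd_start red x)]. length x) + poly W n)"
        by (rule steps_boundD[OF TF _ ans]) (use x Oc in blast)
      then show "steps (oc_oracles red Oc) finish_prog [unary n, r, \<sigma>, x]
          \<le> poly TF (n + length r + length \<sigma> + length x + poly W n)"
        by (simp add: add.assoc)
    next
      fix H Sg :: "bits \<Rightarrow> bits"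
      assume "\<And>r. length (H r) \<le> poly W n" "\<And>r. length (Sg r) \<le> poly W n"
      then obtain t \<tau> s where e: "exec (forger_oracles H Sg) (adv_prog A) (init_store [unary n, x, \<rho>]) t \<tau> s"
        and t: "t \<le> poly TA (length (unary n) + length x + length \<rho> + poly W n)"
        using TA[of H "poly W n" Sg "unary n" x \<rho>] by blast
      have "length (unary n) + length x + length \<rho> + poly W n \<le> 4 * poly W n"
        using key n rho by simp
      from le_trans[OF t poly_mono_nat[OF this]] have "t \<le> poly t0 n"
        by (simp add: t0_def poly_pcompose)
      with e show "\<exists>t \<tau> s. exec (forger_oracles H Sg) (adv_prog A) (init_store [unary n, x, \<rho>]) t \<tau> s \<and> t \<le> poly t0 n"
        by blast
    qed
    then show ?thesis by (simp add: T_def poly_pcompose Z)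
  qed
  then have "\<exists>T :: nat poly. \<forall>n. \<forall>x \<in> pks n. \<forall>\<rho> \<in> set_pmf (coins A n). \<forall>Oc \<in> oc_values red n x.
      total_time red A (Copy 0 1) PR sign_prog finish_prog n x \<rho> Oc \<le> poly T n"
    by blast
  then show ?thesis
    unfolding hf_efficient_def
    using PR solves_start solves_sign solves_finish
    by (intro exI[of _ "Copy 0 1"] exI[of _ PR] exI[of _ sign_prog] exI[of _ finish_prog] conjI) simp_all
qed

end

theorem theorem4p7:
  fixes F1 F2 :: tdp and q :: "nat \<Rightarrow> nat"
  assumes "claw_free_pair F1 F2"
    and "\<exists>Q :: nat poly. \<forall>n. q n \<le> poly Q n"
  shows "\<exists>p :: nat poly. (\<forall>n. poly p n \<ge> 1) \<and>
           (\<forall>A. ppt_adversary A \<longrightarrow> signing_queries_le (fdh F1) A q \<longrightarrow>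
              history_free (fdh F1) (claw_problem F1 F2) (claw_reduction F1 F2 (poly p)) A)"
proof -
  obtain Q :: "nat poly" where Q: "\<And>n. q n \<le> poly Q n" using assms(2) by blast
  \<comment> \<open>The bound \<open>q\<close> need not be a polynomial, so \<open>Q\<close> takes
    its place; the summand 1 keeps the set of marks nonempty where \<open>Q\<close>
    vanishes.\<close>
  define p where "p = smult 2 Q + 1"
  have p: "1 \<le> poly p n" "2 * q n \<le> poly p n" for n
    using Q[of n] by (simp_all add: p_def)
  have "history_free (fdh F1) (claw_problem F1 F2) (claw_reduction F1 F2 (poly p)) A"
    if "ppt_adversary A" "signing_queries_le (fdh F1) A q" for A
    unfolding history_free_def
    by (intro conjI hf_efficient_claw[OF assms(1) p(1) that(1)] hf_instance_claw
        hf_rand_claw[OF assms(1) p(1)] hf_sign_claw[OF assms(1) p(1)]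
        hf_no_abort_claw[OF assms(1) p that] hf_finish_claw[OF assms(1) p(1) that(1)])
  then show ?thesis using p(1) by blast
qed

end
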